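(* Let $G=(V,E)$ be an LWF chain graph on a finite set $V$ of random variables, all of them observed (causal sufficiency), and let $P$ be a joint distribution over $V$ that satisfies the global Markov property with respect to $G$ and is faithful to $G$. Consider the large sample limit for i.i.d. sampling from $P$, i.e. every conditional independence test made by an algorithm returns the correct answer for $P$. Then each of the algorithms GS, IAMB, MBC-CSP, fastIAMB, interIAMB and fdrIAMB correctly identifies all Markov blankets: for every $T\in V$, the algorithm run with target $T$ returns exactly $$\mathbf{Mb}(T)=bd(T)\cup ch(T)\cup csp(T).$$
   Context: Graphs are finite and simple, each edge directed ($u\to v$) or undirected ($u-v$). A partially directed cycle is a sequence $v_1,\dots,v_n$, $n\ge3$, $v_n=v_1$, otherwise distinct, with $v_i-v_{i+1}$ or $v_i\to v_{i+1}$ for each $i<n$ and at least one edge $v_j\to v_{j+1}$. An LWF chain graph (CG) has no partially directed cycle. $pa(v)=\{u:u\to v\}$, $ch(v)=\{u:v\to u\}$, $ne(v)=\{u:u-v\}$. $bd(A)$ is the set of vertices in $V\setminus A$ that are parents or neighbors of some vertex of $A$; $bd(v)=pa(v)\cup ne(v)$. $A$ is ancestral if $bd(a)\subseteq A$ for all $a\in A$; $An(A)$ is the smallest ancestral set containing $A$. A minimal complex is an induced subgraph $a\to v_1-\cdots-v_r\gets b$, $r\ge1$; $csp(a)$ is the set of $b$ for which such a minimal complex exists. The moral graph $G^m$ is the undirected graph on the same vertices with $\alpha,\beta$ adjacent iff they are adjacent in $G$ or $\alpha\in csp(\beta)$. For disjoint $A,B,S$, $S$ $c$-separates $A$ from $B$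 in $G$ if $S$ separates $A$ from $B$ in $(G_{An(A\cup B\cup S)})^m$, where $G_A$ is the subgraph induced on $A$. Global Markov property: if $S$ $c$-separates $A$ from $B$ then $A\perp\!\!\!\perp B\mid S$ under $P$ ($A,B,S$ disjoint). Faithfulness: for all distinct $X,Y\in V$ and $Z\subseteq V\setminus\{X,Y\}$, if $Z$ does not $c$-separate $X$ from $Y$ then $X\not\perp\!\!\!\perp Y\mid Z$ under $P$. Algorithms, with target $T$. In all of them $C\subseteq V\setminus\{T\}$ is the current candidate set, initially $\varnothing$ unless said otherwise, and "$Y$ is (in)dependent given $S$" means $Y$ is (in)dependent of $T$ given $S$ under $P$. The results hold for any choices or orderings left unspecified. "Shrink" means: while some $Y\in C$ is independent given $C\setminus\{Y\}$, remove one such $Y$ from $C$. - GS: while some $Y\in V\setminus(C\cup\{T\})$ is dependent given $C$, add such a $Y$ to $C$; then shrink; return $C$. - IAMB: as GS, but the variable considered at each growing step is a $Y\in V\setminus(C\cup\{T\})$ maximizing a conditional association measure $f(Y;T\mid C)\ge0$, where $f(Y;T\mid C)=0$ iff $Y$ is independent given $C$; it is added if it is dependent given $C$, otherwise growing stops; then shrink; return $C$. - interIAMB: as IAMB, but the shrink procedure is run after each addition of a variable; repeat until no variable can be added; return $C$. - fastIAMB: repeat: add to $C$ simultaneously all $Y\in V\setminus(C\cup\{T\})$ that are dependent given $C$ (in the large sample limit all tests are regarded as reliable), then shrink; until no $Y\in V\setminus(C\cup\{T\})$ is dependent given $C$; return $C$. - fdrIAMB: repeat: if some $Y\in C$ is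 independent given $C\setminus\{Y\}$, remove one such $Y$; otherwise, if some $Y\in V\setminus(C\cup\{T\})$ is dependent given $C$, add one such $Y$; otherwise stop and return $C$. (At finite sample size the decisions are made with false-discovery-rate-adjusted $p$-values; in the limit they are correct.) - MBC-CSP: Step 1. Let $adj$ be the set of $V_i\in V\setminus\{T\}$ marginally dependent on $T$; for the other $V_i$ set $\mathrm{Sepset}(T,V_i)=\varnothing$. Order $adj$ by increasing correlation with $T$. For $k=1,2,\dots$, as long as $k\le|adj|$: for each $V_j\in adj$ in turn, if there is $S\subseteq adj\setminus\{V_j\}$ with $|S|=k$ and $V_j$ independent given $S$, remove $V_j$ from $adj$ and set $\mathrm{Sepset}(T,V_j)=S$. Step 2. Let $Q$ be the set of all $V_j\in V\setminus(adj\cup\{T\})$ such that for some $V_i\in adj$, $V_j$ is independent given $\mathrm{Sepset}(T,V_j)$ and dependent given $\mathrm{Sepset}(T,V_j)\cup\{V_i\}$. Step 3. Set $C=adj\cup Q$; shrink (at finite sample size the removed variable is the one with the largest $p$-value); return $C$. *)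

theory Defs
  imports "HOL-Probability.Probability"
begin

section \<open>LWF chain graphs\<close>

text \<open>An undirected edge is represented by both of its orientations in \<open>lines\<close>.\<close>

record 'v mixed_graph =
  verts :: "'v set"
  arrows :: "('v \<times> 'v) set"
  lines :: "('v \<times> 'v) set"

definition simple_mixed_graph :: "'v mixed_graph \<Rightarrow> bool" where
  "simple_mixed_graph G \<longleftrightarrow>
     finite (verts G) \<and>
     arrows G \<subseteq> verts G \<times> verts G \<and> lines G \<subseteq> verts G \<times> verts G \<and>
     irrefl (arrows G) \<and> irrefl (lines G) \<and> sym (lines G) \<and>
     (\<forall>u v. (u, v) \<in> arrows G \<longrightarrow> (v, u) \<notin> arrows G \<and> (u, v) \<notin> lines G)"

definition partially_directed_cycle :: "'v mixed_graph \<Rightarrow> 'v list \<Rightarrow> bool" where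
  "partially_directed_cycle G vs \<longleftrightarrow>
     length vs \<ge> 3 \<and> last vs = hd vs \<and> distinct (butlast vs) \<and>
     (\<forall>i. Suc i < length vs \<longrightarrow> (vs ! i, vs ! Suc i) \<in> lines G \<union> arrows G) \<and>
     (\<exists>j. Suc j < length vs \<and> (vs ! j, vs ! Suc j) \<in> arrows G)"

definition lwf_chain_graph :: "'v mixed_graph \<Rightarrow> bool" where
  "lwf_chain_graph G \<longleftrightarrow>
     simple_mixed_graph G \<and> (\<nexists>vs. partially_directed_cycle G vs)"

definition pa :: "'v mixed_graph \<Rightarrow> 'v \<Rightarrow> 'v set" where
  "pa G v = {u. (u, v) \<in> arrows G}"

definition ch :: "'v mixed_graph \<Rightarrow> 'v \<Rightarrow> 'v set" where
  "ch G v = {u. (v, u) \<in> arrows G}"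

definition ne :: "'v mixed_graph \<Rightarrow> 'v \<Rightarrow> 'v set" where
  "ne G v = {u. (u, v) \<in> lines G}"

definition bd :: "'v mixed_graph \<Rightarrow> 'v \<Rightarrow> 'v set" where
  "bd G v = pa G v \<union> ne G v"

definition ancestral :: "'v mixed_graph \<Rightarrow> 'v set \<Rightarrow> bool" where
  "ancestral G A \<longleftrightarrow> A \<subseteq> verts G \<and> (\<forall>a\<in>A. bd G a \<subseteq> A)"

definition An :: "'v mixed_graph \<Rightarrow> 'v set \<Rightarrow> 'v set" where
  "An G A = \<Inter> {B. ancestral G B \<and> A \<subseteq> B}"

definition induced :: "'v mixed_graph \<Rightarrow> 'v set \<Rightarrow> 'v mixed_graph" where
  "induced G A =
     \<lparr>verts = verts G \<inter> A, arrows = arrows G \<inter> A \<times> A, lines = lines G \<inter> A \<times> A\<rparr>"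

definition path_lines :: "'v list \<Rightarrow> ('v \<times> 'v) set" where
  "path_lines vs =
     {(vs ! i, vs ! Suc i) |i. Suc i < length vs} \<union> {(vs ! Suc i, vs ! i) |i. Suc i < length vs}"

text \<open>The subgraph induced on \<open>a\<close>, \<open>b\<close> and \<open>vs = [v\<^sub>1, \<dots>, v\<^sub>r]\<close> has no edges
  other than those of \<open>a \<rightarrow> v\<^sub>1 - \<dots> - v\<^sub>r \<leftarrow> b\<close>; in particular \<open>a\<close> and \<open>b\<close> are not adjacent.\<close>

definition minimal_complex :: "'v mixed_graph \<Rightarrow> 'v \<Rightarrow> 'v list \<Rightarrow> 'v \<Rightarrow> bool" where
  "minimal_complex G a vs b \<longleftrightarrow>
     vs \<noteq> [] \<and> distinct (a # vs @ [b]) \<and>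
     induced G (set (a # vs @ [b])) =
       \<lparr>verts = set (a # vs @ [b]),
        arrows = {(a, hd vs), (b, last vs)},
        lines = path_lines vs\<rparr>"

definition csp :: "'v mixed_graph \<Rightarrow> 'v \<Rightarrow> 'v set" where
  "csp G a = {b. \<exists>vs. minimal_complex G a vs b}"

definition Mb :: "'v mixed_graph \<Rightarrow> 'v \<Rightarrow> 'v set" where
  "Mb G T = bd G T \<union> ch G T \<union> csp G T"

definition adjacent :: "'v mixed_graph \<Rightarrow> 'v \<Rightarrow> 'v \<Rightarrow> bool" where
  "adjacent G u v \<longleftrightarrow> (u, v) \<in> arrows G \<or> (v, u) \<in> arrows G \<or> (u, v) \<in> lines G"

definition moral :: "'v mixed_graph \<Rightarrow> 'v mixed_graph" where
  "moral G =
     \<lparr>verts = verts G, arrows = {}, lines = {(u, v). adjacent G u v \<or> u \<in> csp G v}\<rparr>"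

definition upath :: "'v mixed_graph \<Rightarrow> 'v list \<Rightarrow> bool" where
  "upath H p \<longleftrightarrow>
     p \<noteq> [] \<and> set p \<subseteq> verts H \<and> distinct p \<and> successively (\<lambda>u v. (u, v) \<in> lines H) p"

definition separates :: "'v mixed_graph \<Rightarrow> 'v set \<Rightarrow> 'v set \<Rightarrow> 'v set \<Rightarrow> bool" where
  "separates H S A B \<longleftrightarrow>
     (\<forall>p. upath H p \<and> hd p \<in> A \<and> last p \<in> B \<longrightarrow> set p \<inter> S \<noteq> {})"

definition c_separates :: "'v mixed_graph \<Rightarrow> 'v set \<Rightarrow> 'v set \<Rightarrow> 'v set \<Rightarrow> bool" where
  "c_separates G S A B \<longleftrightarrow> separates (moral (induced G (An G (A \<union> B \<union> S)))) S A B"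


section \<open>Conditional independence, Markov property, faithfulness\<close>

text \<open>The variable \<open>v \<in> V\<close> takes values in the measurable space \<open>N v\<close>; a joint distribution
  is a probability measure on the product space, whose coordinates are the variables.
  \<open>coord_algebra P N A\<close> is the \<open>\<sigma>\<close>-algebra on \<open>space P\<close> generated by the variables in \<open>A\<close>.\<close>

definition joint_distribution ::
    "'v set \<Rightarrow> ('v \<Rightarrow> 'a measure) \<Rightarrow> ('v \<Rightarrow> 'a) measure \<Rightarrow> bool" where
  "joint_distribution V N P \<longleftrightarrow> prob_space P \<and> sets P = sets (Pi\<^sub>M V N)"

definition coord_algebra ::
    "('v \<Rightarrow> 'a) measure \<Rightarrow> ('v \<Rightarrow> 'a measure) \<Rightarrow> 'v set \<Rightarrow> ('v \<Rightarrow> 'a) measure" where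
  "coord_algebra P N A = vimage_algebra (space P) (\<lambda>x. restrict x A) (Pi\<^sub>M A N)"

definition cond_indep ::
    "('v \<Rightarrow> 'a) measure \<Rightarrow> ('v \<Rightarrow> 'a measure) \<Rightarrow> 'v set \<Rightarrow> 'v set \<Rightarrow> 'v set \<Rightarrow> bool" where
  "cond_indep P N A B S \<longleftrightarrow>
     (\<forall>E \<in> sets (coord_algebra P N A). \<forall>F \<in> sets (coord_algebra P N B).
        AE x in P. real_cond_exp P (coord_algebra P N S) (indicator (E \<inter> F)) x =
          real_cond_exp P (coord_algebra P N S) (indicator E) x *
          real_cond_exp P (coord_algebra P N S) (indicator F) x)"

definition global_markov ::
    "'v mixed_graph \<Rightarrow> ('v \<Rightarrow> 'a measure) \<Rightarrow> ('v \<Rightarrow> 'a) measure \<Rightarrow> bool" where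
  "global_markov G N P \<longleftrightarrow>
     (\<forall>A B S. A \<subseteq> verts G \<and> B \<subseteq> verts G \<and> S \<subseteq> verts G \<and>
        A \<inter> B = {} \<and> A \<inter> S = {} \<and> B \<inter> S = {} \<and> c_separates G S A B \<longrightarrow>
        cond_indep P N A B S)"

definition faithful ::
    "'v mixed_graph \<Rightarrow> ('v \<Rightarrow> 'a measure) \<Rightarrow> ('v \<Rightarrow> 'a) measure \<Rightarrow> bool" where
  "faithful G N P \<longleftrightarrow>
     (\<forall>X \<in> verts G. \<forall>Y \<in> verts G. \<forall>Z. X \<noteq> Y \<and> Z \<subseteq> verts G - {X, Y} \<and>
        \<not> c_separates G Z {X} {Y} \<longrightarrow> \<not> cond_indep P N {X} {Y} Z)"

text \<open>Extended real values, since e.g. conditional mutual information may be infinite.\<close>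

definition association_measure ::
    "'v set \<Rightarrow> ('v \<Rightarrow> 'a measure) \<Rightarrow> ('v \<Rightarrow> 'a) measure \<Rightarrow>
     ('v \<Rightarrow> 'v \<Rightarrow> 'v set \<Rightarrow> ereal) \<Rightarrow> bool" where
  "association_measure V N P f \<longleftrightarrow>
     (\<forall>T \<in> V. \<forall>C. C \<subseteq> V - {T} \<longrightarrow> (\<forall>Y \<in> V - (C \<union> {T}).
        f Y T C \<ge> 0 \<and> (f Y T C = 0 \<longleftrightarrow> cond_indep P N {Y} {T} C)))"


section \<open>The algorithms\<close>

text \<open>The algorithms are nondeterministic transition systems, every choice left open by the
  algorithm being a choice of transition.  They access the distribution only through a test
  \<open>I\<close>, where \<open>I Y S\<close> is the answer to ``is \<open>Y\<close> independent of the target \<open>T\<close> given \<open>S\<close>?''.\<close>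

datatype ('s, 'v) config = Running 's | Returned "'v set"

text \<open>Total correctness: no run is infinite, and a run that cannot be continued has returned
  \<open>R\<close>.  In the systems below \<open>Returned\<close> configurations have no successors, so every maximal run
  is finite and returns \<open>R\<close>.\<close>

definition always_returns ::
    "(('s, 'v) config \<Rightarrow> ('s, 'v) config \<Rightarrow> bool) \<Rightarrow> ('s, 'v) config \<Rightarrow> 'v set \<Rightarrow> bool" where
  "always_returns step c R \<longleftrightarrow>
     (\<nexists>run :: nat \<Rightarrow> ('s, 'v) config. run 0 = c \<and> (\<forall>i. step (run i) (run (Suc i)))) \<and>
     (\<forall>c'. step\<^sup>*\<^sup>* c c' \<and> (\<nexists>c''. step c' c'') \<longrightarrow> c' = Returned R)"

definition ci_test ::
    "('v \<Rightarrow> 'a measure) \<Rightarrow> ('v \<Rightarrow> 'a) measure \<Rightarrow> 'v \<Rightarrow> 'v \<Rightarrow> 'v set \<Rightarrow> bool" where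
  "ci_test N P T Y S \<longleftrightarrow> cond_indep P N {Y} {T} S"

definition dependents ::
    "'v set \<Rightarrow> 'v \<Rightarrow> ('v \<Rightarrow> 'v set \<Rightarrow> bool) \<Rightarrow> 'v set \<Rightarrow> 'v set" where
  "dependents V T I C = {Y \<in> V - (C \<union> {T}). \<not> I Y C}"

definition removable :: "('v \<Rightarrow> 'v set \<Rightarrow> bool) \<Rightarrow> 'v set \<Rightarrow> 'v set" where
  "removable I C = {Y \<in> C. I Y (C - {Y})}"

definition best_candidate ::
    "'v set \<Rightarrow> 'v \<Rightarrow> ('v \<Rightarrow> 'v \<Rightarrow> 'v set \<Rightarrow> ereal) \<Rightarrow> 'v set \<Rightarrow> 'v \<Rightarrow> bool" where
  "best_candidate V T f C Y \<longleftrightarrow>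
     is_arg_max (\<lambda>Z. f Z T C) (\<lambda>Z. Z \<in> V - (C \<union> {T})) Y"

datatype phase = Grow | Shrink

type_synonym 'v gs_config = "(phase \<times> 'v set, 'v) config"

inductive gs_step ::
    "'v set \<Rightarrow> 'v \<Rightarrow> ('v \<Rightarrow> 'v set \<Rightarrow> bool) \<Rightarrow> 'v gs_config \<Rightarrow> 'v gs_config \<Rightarrow> bool"
  for V T I where
  gs_add: "Y \<in> dependents V T I C \<Longrightarrow>
    gs_step V T I (Running (Grow, C)) (Running (Grow, insert Y C))"
| gs_grown: "dependents V T I C = {} \<Longrightarrow>
    gs_step V T I (Running (Grow, C)) (Running (Shrink, C))"
| gs_remove: "Y \<in> removable I C \<Longrightarrow>
    gs_step V T I (Running (Shrink, C)) (Running (Shrink, C - {Y}))"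
| gs_return: "removable I C = {} \<Longrightarrow>
    gs_step V T I (Running (Shrink, C)) (Returned C)"

inductive iamb_step ::
    "'v set \<Rightarrow> 'v \<Rightarrow> ('v \<Rightarrow> 'v \<Rightarrow> 'v set \<Rightarrow> ereal) \<Rightarrow> ('v \<Rightarrow> 'v set \<Rightarrow> bool) \<Rightarrow>
     'v gs_config \<Rightarrow> 'v gs_config \<Rightarrow> bool"
  for V T f I where
  iamb_add: "best_candidate V T f C Y \<Longrightarrow> \<not> I Y C \<Longrightarrow>
    iamb_step V T f I (Running (Grow, C)) (Running (Grow, insert Y C))"
| iamb_grown: "best_candidate V T f C Y \<Longrightarrow> I Y C \<Longrightarrow>
    iamb_step V T f I (Running (Grow, C)) (Running (Shrink, C))"
| iamb_exhausted: "V - (C \<union> {T}) = {} \<Longrightarrow>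
    iamb_step V T f I (Running (Grow, C)) (Running (Shrink, C))"
| iamb_remove: "Y \<in> removable I C \<Longrightarrow>
    iamb_step V T f I (Running (Shrink, C)) (Running (Shrink, C - {Y}))"
| iamb_return: "removable I C = {} \<Longrightarrow>
    iamb_step V T f I (Running (Shrink, C)) (Returned C)"

inductive inter_iamb_step ::
    "'v set \<Rightarrow> 'v \<Rightarrow> ('v \<Rightarrow> 'v \<Rightarrow> 'v set \<Rightarrow> ereal) \<Rightarrow> ('v \<Rightarrow> 'v set \<Rightarrow> bool) \<Rightarrow>
     'v gs_config \<Rightarrow> 'v gs_config \<Rightarrow> bool"
  for V T f I where
  inter_add: "best_candidate V T f C Y \<Longrightarrow> \<not> I Y C \<Longrightarrow>
    inter_iamb_step V T f I (Running (Grow, C)) (Running (Shrink, insert Y C))"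
| inter_remove: "Y \<in> removable I C \<Longrightarrow>
    inter_iamb_step V T f I (Running (Shrink, C)) (Running (Shrink, C - {Y}))"
| inter_shrunk: "removable I C = {} \<Longrightarrow>
    inter_iamb_step V T f I (Running (Shrink, C)) (Running (Grow, C))"
| inter_return: "best_candidate V T f C Y \<Longrightarrow> I Y C \<Longrightarrow>
    inter_iamb_step V T f I (Running (Grow, C)) (Returned C)"
| inter_exhausted: "V - (C \<union> {T}) = {} \<Longrightarrow>
    inter_iamb_step V T f I (Running (Grow, C)) (Returned C)"

inductive fast_iamb_step ::
    "'v set \<Rightarrow> 'v \<Rightarrow> ('v \<Rightarrow> 'v set \<Rightarrow> bool) \<Rightarrow> 'v gs_config \<Rightarrow> 'v gs_config \<Rightarrow> bool"
  for V T I where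
  fast_add: "fast_iamb_step V T I (Running (Grow, C)) (Running (Shrink, C \<union> dependents V T I C))"
| fast_remove: "Y \<in> removable I C \<Longrightarrow>
    fast_iamb_step V T I (Running (Shrink, C)) (Running (Shrink, C - {Y}))"
| fast_repeat: "removable I C = {} \<Longrightarrow> dependents V T I C \<noteq> {} \<Longrightarrow>
    fast_iamb_step V T I (Running (Shrink, C)) (Running (Grow, C))"
| fast_return: "removable I C = {} \<Longrightarrow> dependents V T I C = {} \<Longrightarrow>
    fast_iamb_step V T I (Running (Shrink, C)) (Returned C)"

inductive fdr_iamb_step ::
    "'v set \<Rightarrow> 'v \<Rightarrow> ('v \<Rightarrow> 'v set \<Rightarrow> bool) \<Rightarrow>
     ('v set, 'v) config \<Rightarrow> ('v set, 'v) config \<Rightarrow> bool"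
  for V T I where
  fdr_remove: "Y \<in> removable I C \<Longrightarrow>
    fdr_iamb_step V T I (Running C) (Running (C - {Y}))"
| fdr_add: "removable I C = {} \<Longrightarrow> Y \<in> dependents V T I C \<Longrightarrow>
    fdr_iamb_step V T I (Running C) (Running (insert Y C))"
| fdr_return: "removable I C = {} \<Longrightarrow> dependents V T I C = {} \<Longrightarrow>
    fdr_iamb_step V T I (Running C) (Returned C)"

text \<open>In \<open>Round k L sep\<close> and \<open>Visit k q L sep\<close> the list \<open>L\<close> holds the current set \<open>adj\<close> in
  order, and \<open>q\<close> holds the vertices still to be considered in round \<open>k\<close>.  \<open>sep v = None\<close> means
  that \<open>Sepset(T, v)\<close> has not been assigned.\<close>

datatype 'v mbc_state =
    Start
  | Round nat "'v list" "'v \<Rightarrow> 'v set option"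
  | Visit nat "'v list" "'v list" "'v \<Rightarrow> 'v set option"
  | Final_Shrink "'v set"

type_synonym 'v mbc_config = "('v mbc_state, 'v) config"

definition mbc_spouses ::
    "'v set \<Rightarrow> 'v \<Rightarrow> ('v \<Rightarrow> 'v set \<Rightarrow> bool) \<Rightarrow> 'v set \<Rightarrow> ('v \<Rightarrow> 'v set option) \<Rightarrow> 'v set" where
  "mbc_spouses V T I adj sep =
     {v \<in> V - (adj \<union> {T}). \<exists>w \<in> adj. \<exists>S. sep v = Some S \<and> I v S \<and> \<not> I v (S \<union> {w})}"

inductive mbc_csp_step ::
    "'v set \<Rightarrow> 'v \<Rightarrow> ('v \<Rightarrow> 'v \<Rightarrow> real) \<Rightarrow> ('v \<Rightarrow> 'v set \<Rightarrow> bool) \<Rightarrow>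
     'v mbc_config \<Rightarrow> 'v mbc_config \<Rightarrow> bool"
  for V T corr I where
  mbc_start: "set L = {v \<in> V - {T}. \<not> I v {}} \<Longrightarrow> distinct L \<Longrightarrow>
    sorted_wrt (\<lambda>u v. corr T u \<le> corr T v) L \<Longrightarrow>
    mbc_csp_step V T corr I (Running Start)
      (Running (Round 1 L (\<lambda>v. if v \<in> V - {T} \<and> I v {} then Some {} else None)))"
| mbc_round: "k \<le> length L \<Longrightarrow>
    mbc_csp_step V T corr I (Running (Round k L sep)) (Running (Visit k L L sep))"
| mbc_separated: "S \<subseteq> set L - {v} \<Longrightarrow> card S = k \<Longrightarrow> I v S \<Longrightarrow>
    mbc_csp_step V T corr I (Running (Visit k (v # q) L sep))
      (Running (Visit k q (remove1 v L) (sep(v \<mapsto> S))))"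
| mbc_kept: "(\<nexists>S. S \<subseteq> set L - {v} \<and> card S = k \<and> I v S) \<Longrightarrow>
    mbc_csp_step V T corr I (Running (Visit k (v # q) L sep)) (Running (Visit k q L sep))"
| mbc_round_done:
    "mbc_csp_step V T corr I (Running (Visit k [] L sep)) (Running (Round (Suc k) L sep))"
| mbc_candidates: "k > length L \<Longrightarrow>
    mbc_csp_step V T corr I (Running (Round k L sep))
      (Running (Final_Shrink (set L \<union> mbc_spouses V T I (set L) sep)))"
| mbc_remove: "Y \<in> removable I C \<Longrightarrow>
    mbc_csp_step V T corr I (Running (Final_Shrink C)) (Running (Final_Shrink (C - {Y})))"
| mbc_return: "removable I C = {} \<Longrightarrow>
    mbc_csp_step V T corr I (Running (Final_Shrink C)) (Returned C)"

end

(* The Markov blanket of T is exactly the set of neighbours of T in the moral graph, as long as the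
   ancestral set contains the complexes that produce its csp part.  Hence, by the Markov property and
   faithfulness: neighbours, parents and children of T are dependent on T given anything; a member of
   csp(T) is dependent on T given any set containing the first vertex of its complex, which is a
   child of T; and every vertex outside a superset S of the blanket is independent of T given S.
   These three facts determine the outcome of every terminating run.

   Termination of the algorithms that alternate between growing and shrinking does not follow from
   cardinalities.  The potential used here is the family of real numbers E (P(T in B | C)^2), where
   B ranges over the measurable sets: each is unchanged when a variable that is conditionally
   independent given the remaining candidates is removed, none decreases when variables are added,
   and one of them increases when a dependent variable is added. *)

theory Submission imports Defs begin

section \<open>Separation in chain graphs\<close>

lemma subset_An: "A \<subseteq> An G A"
  by (auto simp: An_def)

lemma An_closed: "a \<in> An G A \<Longrightarrow> bd G a \<subseteq> An G A"
  by (auto simp: An_def ancestral_def)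

lemma minimal_complexD:
  assumes "minimal_complex G a vs b"
  shows "vs \<noteq> []" and "distinct (a # vs @ [b])" and "set (a # vs @ [b]) \<subseteq> verts G"
    and "(a, hd vs) \<in> arrows G" and "path_lines vs \<subseteq> lines G"
proof -
  let ?W = "set (a # vs @ [b])"
  have eq: "verts G \<inter> ?W = ?W" "arrows G \<inter> ?W \<times> ?W = {(a, hd vs), (b, last vs)}"
      "lines G \<inter> ?W \<times> ?W = path_lines vs"
    using assms by (simp_all add: minimal_complex_def induced_def)
  show "vs \<noteq> []" "distinct (a # vs @ [b])"
    using assms by (simp_all add: minimal_complex_def)
  show "?W \<subseteq> verts G" "(a, hd vs) \<in> arrows G" "path_lines vs \<subseteq> lines G"
    using eq by blast+
qed

text \<open>Inducing on \<open>D\<close> and then on a subset of \<open>D\<close> is the same as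
  inducing on that subset at once, so both graphs impose the same equation on the complex. A complex
  of the induced graph cannot leave \<open>D\<close>, since its vertices are vertices of that
  graph.\<close>

lemma minimal_complex_induced_iff:
  "minimal_complex (induced G D) a vs b \<longleftrightarrow>
    minimal_complex G a vs b \<and> set (a # vs @ [b]) \<subseteq> D"
proof -
  have ind: "induced (induced G D) W = induced G W" if "W \<subseteq> D" for W
    using that by (auto simp: induced_def)
  show ?thesis
  proof (cases "set (a # vs @ [b]) \<subseteq> D")
    case True
    then show ?thesis by (simp only: minimal_complex_def ind[OF True] simp_thms)
  next
    case False
    then show ?thesis
      using minimal_complexD(3)[of "induced G D" a vs b] by (auto simp: induced_def)
  qed
qed

lemma csp_subset: "csp G T \<subseteq> verts G - {T}"
proof
  fix b assume "b \<in> csp G T"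
  then obtain vs where mc: "minimal_complex G T vs b" by (auto simp: csp_def)
  show "b \<in> verts G - {T}"
    using minimal_complexD(2,3)[OF mc] by auto
qed

lemma Mb_subset: "simple_mixed_graph G \<Longrightarrow> Mb G T \<subseteq> verts G - {T}"
  using csp_subset[of G T]
  by (auto simp: Mb_def simple_mixed_graph_def bd_def pa_def ne_def ch_def irrefl_def)

text \<open>Edges and complexes of an induced subgraph are already present in \<open>G\<close>.
  Passing to a subgraph can therefore only lose moral neighbours of \<open>T\<close>, never create
  new ones.\<close>

lemma moral_induced_neighbour_in_Mb:
  assumes "(u, T) \<in> lines (moral (induced G D))"
  shows "u \<in> Mb G T"
proof -
  have "adjacent (induced G D) u T \<or> u \<in> csp (induced G D) T"
    using assms by (simp add: moral_def)
  moreover have "csp (induced G D) T \<subseteq> csp G T"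
    by (auto simp: csp_def minimal_complex_induced_iff)
  ultimately show ?thesis
    by (auto simp: adjacent_def induced_def Mb_def bd_def pa_def ne_def ch_def)
qed

text \<open>The last vertex before \<open>T\<close> on any path is a moral neighbour of
  \<open>T\<close>, hence lies in the blanket and so in \<open>S\<close>.\<close>

lemma Mb_c_separates:
  assumes "Mb G T \<subseteq> S" and "Y \<noteq> T"
  shows "c_separates G S {Y} {T}"
  unfolding c_separates_def separates_def
proof (intro allI impI; elim conjE)
  fix p let ?H = "moral (induced G (An G ({Y} \<union> {T} \<union> S)))"
  assume p: "upath ?H p" "hd p \<in> {Y}" "last p \<in> {T}"
  obtain p' where p': "p = p' @ [T]"
    using p by (metis append_butlast_last_id singletonD upath_def)
  \<comment> \<open>There is a vertex before \<open>T\<close> because the path starts at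
    \<open>Y\<close>, which differs from \<open>T\<close>.\<close>
  with p(2) assms(2) obtain q u where "p' = q @ [u]"
    by (cases p' rule: rev_cases) auto
  with p p' have "(u, T) \<in> lines ?H" "u \<in> set p"
    by (auto simp: upath_def successively_append_iff)
  with moral_induced_neighbour_in_Mb[OF this(1)] assms(1) show "set p \<inter> S \<noteq> {}"
    by auto
qed

text \<open>Every failure of c-separation established below is witnessed by the path consisting of
  the two vertices alone, which cannot meet \<open>S\<close>.\<close>

lemma not_c_separates_if_moral_edge:
  assumes "{Y, T} \<subseteq> verts G" "Y \<noteq> T" "Y \<notin> S" "T \<notin> S"
    and "(Y, T) \<in> lines (moral (induced G (An G ({Y} \<union> {T} \<union> S))))"
  shows "\<not> c_separates G S {Y} {T}"
proof -
  let ?D = "An G ({Y} \<union> {T} \<union> S)"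
  have "{Y, T} \<subseteq> ?D" using subset_An[of "{Y} \<union> {T} \<union> S" G] by auto
  then have "upath (moral (induced G ?D)) [Y, T]"
    using assms by (auto simp: upath_def moral_def induced_def)
  then show ?thesis
    using assms(3,4) unfolding c_separates_def separates_def by force
qed

text \<open>The ancestral set contains both \<open>Y\<close> and \<open>T\<close>, so their edge
  survives in the induced subgraph and in its moral graph whatever \<open>S\<close> is.\<close>

lemma not_c_separates_adjacent:
  assumes "simple_mixed_graph G" "T \<in> verts G" "Y \<in> bd G T \<union> ch G T" "Y \<notin> S" "T \<notin> S"
  shows "\<not> c_separates G S {Y} {T}"
proof -
  have Y: "Y \<in> verts G" "Y \<noteq> T"
    using assms(3) Mb_subset[OF assms(1)] by (auto simp: Mb_def)
  let ?D = "An G ({Y} \<union> {T} \<union> S)"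
  have "{Y, T} \<subseteq> ?D" using subset_An[of "{Y} \<union> {T} \<union> S" G] by auto
  then have "adjacent (induced G ?D) Y T"
    using assms(3) by (auto simp: adjacent_def induced_def bd_def pa_def ne_def ch_def)
  then show ?thesis
    using assms Y by (intro not_c_separates_if_moral_edge) (auto simp: moral_def)
qed

text \<open>Neighbours belong to the boundary, under which an ancestral set is closed. Membership
  thus spreads from the head along the undirected path.\<close>

lemma path_lines_subset_An:
  assumes "path_lines vs \<subseteq> lines G" "vs \<noteq> []" "hd vs \<in> An G A"
  shows "set vs \<subseteq> An G A"
proof -
  have "vs ! i \<in> An G A" if "i < length vs" for i
    using that
  proof (induction i)
    case 0
    then show ?case using assms by (simp add: hd_conv_nth)
  next
    case (Suc i)
    \<comment> \<open>\<open>ne\<close> collects first components, so the edge is taken in the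
      orientation that ends in the vertex already known to be in the set.\<close>
    have "(vs ! Suc i, vs ! i) \<in> path_lines vs"
      using Suc.prems by (auto simp: path_lines_def)
    with assms(1) have "vs ! Suc i \<in> bd G (vs ! i)"
      by (auto simp: bd_def ne_def)
    with Suc show ?case using An_closed[of "vs ! i" G A] by auto
  qed
  then show ?thesis by (auto simp: in_set_conv_nth)
qed

text \<open>Conditioning on the first vertex \<open>v\<^sub>1\<close> of the complex \<open>T \<rightarrow> v\<^sub>1 - \<dots> - v\<^sub>r \<leftarrow> Y\<close>
  puts the whole complex into the ancestral set, so that moralization joins \<open>T\<close> and \<open>Y\<close>.\<close>

lemma not_c_separates_csp:
  assumes "Y \<in> csp G T"
  obtains w where "w \<in> ch G T"
    and "\<And>S. w \<in> S \<Longrightarrow> Y \<notin> S \<Longrightarrow> T \<notin> S \<Longrightarrow> \<not> c_separates G S {Y} {T}"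
proof -
  from assms obtain vs where mc: "minimal_complex G T vs Y" by (auto simp: csp_def)
  note mcD = minimal_complexD[OF mc]
  show ?thesis
  proof (rule that)
    show "hd vs \<in> ch G T" using mcD(4) by (simp add: ch_def)
    fix S assume S: "hd vs \<in> S" "Y \<notin> S" "T \<notin> S"
    let ?D = "An G ({Y} \<union> {T} \<union> S)"
    have D: "{Y} \<union> {T} \<union> S \<subseteq> ?D" by (rule subset_An)
    moreover have "set vs \<subseteq> ?D"
      using mcD(1,5) S(1) D by (intro path_lines_subset_An) auto
    ultimately have "minimal_complex (induced G ?D) T vs Y"
      using mc by (simp add: minimal_complex_induced_iff)
    then have "Y \<in> csp (induced G ?D) T" by (auto simp: csp_def)
    then show "\<not> c_separates G S {Y} {T}"
      using mcD(2,3) S by (intro not_c_separates_if_moral_edge) (auto simp: moral_def)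
  qed
qed

section \<open>Second moments of conditional probabilities\<close>

context prob_space
begin

lemma sigma_finite_subalgebra_if_subalgebra:
  assumes "subalgebra M H"
  shows "sigma_finite_subalgebra M H"
proof -
  interpret finite_measure_subalgebra M H
    by unfold_locales fact
  show ?thesis by unfold_locales
qed

lemma real_cond_exp_indicator_bounds:
  assumes "subalgebra M H" and "E \<in> events"
  shows "AE x in M. 0 \<le> real_cond_exp M H (indicator E) x \<and> real_cond_exp M H (indicator E) x \<le> 1"
proof -
  interpret sigma_finite_subalgebra M H
    by (rule sigma_finite_subalgebra_if_subalgebra) fact
  have int: "integrable M (indicator E :: _ \<Rightarrow> real)"
    using assms(2) by (simp add: emeasure_eq_measure)
  have "AE x in M. 0 \<le> real_cond_exp M H (indicator E) x"
    by (rule real_cond_exp_ge_c[OF int]) simp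
  moreover have "AE x in M. real_cond_exp M H (indicator E) x \<le> 1"
    by (rule real_cond_exp_le_c[OF int]) (simp add: indicator_def)
  ultimately show ?thesis by eventually_elim simp
qed

lemma integrable_real_cond_exp_indicator_mult:
  assumes "subalgebra M H" "subalgebra M K" and "D \<in> events" "E \<in> events"
  shows "integrable M (\<lambda>x. real_cond_exp M H (indicator D) x * real_cond_exp M K (indicator E) x)"
proof (rule integrable_const_bound[where B = 1])
  show "AE x in M. norm (real_cond_exp M H (indicator D) x * real_cond_exp M K (indicator E) x) \<le> 1"
    using real_cond_exp_indicator_bounds[OF assms(1,3)] real_cond_exp_indicator_bounds[OF assms(2,4)]
    by eventually_elim (simp add: mult_le_one abs_mult)
qed measurable

lemma integrable_real_cond_exp_indicator:
  assumes "subalgebra M H" and "E \<in> events"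
  shows "integrable M (real_cond_exp M H (indicator E))"
proof -
  interpret sigma_finite_subalgebra M H
    by (rule sigma_finite_subalgebra_if_subalgebra) fact
  show ?thesis
    using assms(2) by (intro real_cond_exp_int) (simp add: emeasure_eq_measure)
qed

text \<open>For a subalgebra \<open>H\<close> this is the squared L2 norm of the orthogonal
  projection of the indicator of \<open>E\<close> onto the \<open>H\<close>-measurable
  functions.\<close>

definition cond_prob_energy :: "'a set \<Rightarrow> 'a measure \<Rightarrow> real" where
  "cond_prob_energy E H = (\<integral>x. (real_cond_exp M H (indicator E) x)\<^sup>2 \<partial>M)"

text \<open>Pythagoras: the conditional probability given \<open>H\<close> is the orthogonal
  projection of the one given the larger \<open>K\<close>, so the squared distance of the two is the
  difference of their squared norms.\<close>

lemma cond_prob_energy_diff: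
  assumes "subalgebra M K" "subalgebra K H" "E \<in> events"
  shows "(\<integral>x. (real_cond_exp M K (indicator E) x - real_cond_exp M H (indicator E) x)\<^sup>2 \<partial>M)
    = cond_prob_energy E K - cond_prob_energy E H" (is "?L = _")
    and "integrable M (\<lambda>x. (real_cond_exp M K (indicator E) x - real_cond_exp M H (indicator E) x)\<^sup>2)"
proof -
  let ?h = "real_cond_exp M H (indicator E)" and ?k = "real_cond_exp M K (indicator E)"
  have MH: "subalgebra M H"
    using assms by (auto simp: subalgebra_def)
  interpret H: sigma_finite_subalgebra M H
    by (rule sigma_finite_subalgebra_if_subalgebra) fact
  interpret K: sigma_finite_subalgebra M K
    by (rule sigma_finite_subalgebra_if_subalgebra) fact
  have hK: "?h \<in> borel_measurable K"
    by (rule measurable_from_subalg[OF assms(2)]) simp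
  have hE: "integrable M (\<lambda>x. ?h x * indicator E x)"
    using integrable_real_mult_indicator[OF assms(3) integrable_real_cond_exp_indicator[OF MH assms(3)]]
    by (simp add: mult.commute)
  \<comment> \<open>\<open>?h\<close> is measurable for \<open>H\<close> and for \<open>K\<close>.
    Hence its products with \<open>?h\<close> and with \<open>?k\<close> both integrate to the
    integral of \<open>?h\<close> over \<open>E\<close>, and the mixed term of the square becomes
    twice the energy of \<open>H\<close>.\<close>
  have hh: "(\<integral>x. ?h x * ?h x \<partial>M) = (\<integral>x. ?h x * indicator E x \<partial>M)"
    using assms(3) by (intro H.real_cond_exp_intg(2) hE) auto
  have hk: "(\<integral>x. ?h x * ?k x \<partial>M) = (\<integral>x. ?h x * indicator E x \<partial>M)"
    using assms(3) by (intro K.real_cond_exp_intg(2) hE hK) auto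
  have *: "(\<lambda>x. (?k x - ?h x)\<^sup>2) = (\<lambda>x. ?k x * ?k x - 2 * (?h x * ?k x) + ?h x * ?h x)"
    by (auto simp: power2_eq_square algebra_simps)
  note [simp] = integrable_real_cond_exp_indicator_mult[OF _ _ assms(3) assms(3)] assms(1) MH
  have "?L = (\<integral>x. ?k x * ?k x \<partial>M) - 2 * (\<integral>x. ?h x * ?k x \<partial>M) + (\<integral>x. ?h x * ?h x \<partial>M)"
    unfolding * by simp
  then show "?L = cond_prob_energy E K - cond_prob_energy E H"
    unfolding cond_prob_energy_def power2_eq_square hk hh by simp
  show "integrable M (\<lambda>x. (?k x - ?h x)\<^sup>2)"
    unfolding * by simp
qed

lemma cond_prob_energy_mono:
  assumes "subalgebra M K" "subalgebra K H" "E \<in> events"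
  shows "cond_prob_energy E H \<le> cond_prob_energy E K"
proof -
  have "0 \<le> cond_prob_energy E K - cond_prob_energy E H"
    unfolding cond_prob_energy_diff(1)[OF assms, symmetric] by simp
  then show ?thesis by simp
qed

text \<open>Equality in the Pythagorean identity: a nonnegative square with integral zero vanishes
  almost everywhere.\<close>

lemma cond_prob_energy_eq_imp:
  assumes "subalgebra M K" "subalgebra K H" "E \<in> events"
    and "cond_prob_energy E H = cond_prob_energy E K"
  shows "AE x in M. real_cond_exp M K (indicator E) x = real_cond_exp M H (indicator E) x"
proof -
  have "AE x in M. (real_cond_exp M K (indicator E) x - real_cond_exp M H (indicator E) x)\<^sup>2 = 0"
    using cond_prob_energy_diff[OF assms(1-3)] assms(4)
    by (subst integral_nonneg_eq_0_iff_AE[symmetric]) auto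
  then show ?thesis by simp
qed

lemma cond_prob_energy_cong:
  assumes "AE x in M. real_cond_exp M K (indicator E) x = real_cond_exp M H (indicator E) x"
  shows "cond_prob_energy E K = cond_prob_energy E H"
  unfolding cond_prob_energy_def
  by (rule integral_cong_AE) (use assms in auto)

text \<open>Hypothesis \<open>eq\<close> says that \<open>K\<close> tells nothing about
  \<open>E\<close> beyond \<open>H\<close>. Pull the indicator of \<open>D\<close> out of the
  conditional expectation given \<open>K\<close>, replace P(E | K) by P(E | H), then condition on
  \<open>H\<close> with the tower property and pull P(E | H) out.\<close>

lemma real_cond_exp_indicator_Int:
  assumes "subalgebra M K" "subalgebra K H" "D \<in> sets K" "E \<in> events"
    and eq: "AE x in M. real_cond_exp M K (indicator E) x = real_cond_exp M H (indicator E) x"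
  shows "AE x in M. real_cond_exp M H (indicator (D \<inter> E)) x =
    real_cond_exp M H (indicator D) x * real_cond_exp M H (indicator E) x"
proof -
  let ?h = "real_cond_exp M H (indicator E)" and ?k = "real_cond_exp M K (indicator E)"
  have MH: "subalgebra M H"
    using assms by (auto simp: subalgebra_def)
  interpret H: sigma_finite_subalgebra M H
    by (rule sigma_finite_subalgebra_if_subalgebra) fact
  interpret K: sigma_finite_subalgebra M K
    by (rule sigma_finite_subalgebra_if_subalgebra) fact
  have D: "D \<in> events"
    using assms(1,3) by (auto simp: subalgebra_def)
  have DE: "(\<lambda>x. indicator D x * indicator E x) = (indicator (D \<inter> E) :: 'a \<Rightarrow> real)"
    by (auto simp: indicator_def)
  have int: "integrable M (indicator (D \<inter> E) :: 'a \<Rightarrow> real)"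
    using D assms(4) by (simp add: emeasure_eq_measure)
  have hD: "integrable M (\<lambda>x. ?h x * indicator D x)"
    using integrable_real_mult_indicator[OF D integrable_real_cond_exp_indicator[OF MH assms(4)]]
    by (simp add: mult.commute)
  have "AE x in M. real_cond_exp M K (\<lambda>x. indicator D x * indicator E x) x = indicator D x * ?k x"
    using D assms(3,4) int unfolding DE[symmetric] by (intro K.real_cond_exp_mult) auto
  then have "AE x in M. real_cond_exp M K (indicator (D \<inter> E)) x = ?h x * indicator D x"
    unfolding DE using eq by eventually_elim (simp add: mult.commute)
  then have "AE x in M. real_cond_exp M H (real_cond_exp M K (indicator (D \<inter> E))) x =
      real_cond_exp M H (\<lambda>x. ?h x * indicator D x) x"
    using D by (intro H.real_cond_exp_cong) auto
  moreover have "AE x in M. real_cond_exp M H (\<lambda>x. ?h x * indicator D x) x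
      = ?h x * real_cond_exp M H (indicator D) x"
    using D hD by (intro H.real_cond_exp_mult) auto
  moreover have "AE x in M. real_cond_exp M H (real_cond_exp M K (indicator (D \<inter> E))) x
      = real_cond_exp M H (indicator (D \<inter> E)) x"
    by (rule H.real_cond_exp_nested_subalg) fact+
  ultimately show ?thesis
    by eventually_elim (simp add: mult.commute)
qed

text \<open>This is the converse direction. The sets \<open>D \<inter> B\<close> form a generator of
  \<open>K\<close> stable under intersection. On them the integrals of the indicator of
  \<open>E\<close> and of P(E | H) agree by conditional independence, and Dynkin's argument extends
  this to all of \<open>K\<close>. Since P(E | H) is \<open>K\<close>-measurable, it is a version of
  P(E | K).\<close>

lemma real_cond_exp_indicator_generated:
  assumes "subalgebra M L" "subalgebra M H" "subalgebra M K" "subalgebra K H"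
    and gen: "sets K = sigma_sets (space M) {D \<inter> B |D B. D \<in> sets L \<and> B \<in> sets H}"
    and "E \<in> events"
    and indep: "\<And>D. D \<in> sets L \<Longrightarrow> AE x in M. real_cond_exp M H (indicator (D \<inter> E)) x =
      real_cond_exp M H (indicator D) x * real_cond_exp M H (indicator E) x"
  shows "AE x in M. real_cond_exp M K (indicator E) x = real_cond_exp M H (indicator E) x"
proof -
  let ?h = "real_cond_exp M H (indicator E)"
  let ?G = "{D \<inter> B |D B. D \<in> sets L \<and> B \<in> sets H}"
  interpret H: sigma_finite_subalgebra M H
    by (rule sigma_finite_subalgebra_if_subalgebra) fact
  interpret K: sigma_finite_subalgebra M K
    by (rule sigma_finite_subalgebra_if_subalgebra) fact
  have spaces: "space L = space M" "space H = space M" "sets L \<subseteq> events" "sets H \<subseteq> events"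
    "sets K \<subseteq> events"
    using assms(1-3) by (auto simp: subalgebra_def)
  have intE: "integrable M (indicator E :: 'a \<Rightarrow> real)"
    using assms(6) by (simp add: emeasure_eq_measure)
  have inth: "integrable M ?h"
    by (rule integrable_real_cond_exp_indicator) fact+
  have pi: "Int_stable ?G"
  proof (rule Int_stableI)
    fix a b assume "a \<in> ?G" "b \<in> ?G"
    then obtain D B D' B' where "a = D \<inter> B" "b = D' \<inter> B'" "D \<in> sets L" "D' \<in> sets L"
        "B \<in> sets H" "B' \<in> sets H"
      by blast
    then have "a \<inter> b = (D \<inter> D') \<inter> (B \<inter> B')" "D \<inter> D' \<in> sets L" "B \<inter> B' \<in> sets H"
      by auto
    then show "a \<inter> b \<in> ?G" by blast
  qed
  have pow: "?G \<subseteq> Pow (space M)"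
    using spaces(1) sets.sets_into_space[of _ L] by auto
  \<comment> \<open>The chain is: the integral of P(D \<inter> E | H) over \<open>B\<close>,
    factorized by independence, is that of P(D | H) P(E | H), and this product is the conditional
    expectation of P(E | H) times the indicator of \<open>D\<close>.\<close>
  have rect: "(\<integral>x\<in>D \<inter> B. indicator E x \<partial>M) = (\<integral>x\<in>D \<inter> B. ?h x \<partial>M)"
    if D: "D \<in> sets L" and B: "B \<in> sets H" for D B
  proof -
    have DM: "D \<in> events" and BM: "B \<in> events" using D B spaces by auto
    have hD: "integrable M (\<lambda>x. ?h x * indicator D x)"
      using integrable_real_mult_indicator[OF DM inth] by (simp add: mult.commute)
    have "(\<integral>x\<in>D \<inter> B. indicator E x \<partial>M) = (\<integral>x\<in>B. indicator (D \<inter> E) x \<partial>M)"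
      unfolding set_lebesgue_integral_def by (rule Bochner_Integration.integral_cong) (auto simp: indicator_def)
    also have "\<dots> = (\<integral>x\<in>B. real_cond_exp M H (indicator (D \<inter> E)) x \<partial>M)"
      using DM assms(6) B by (intro H.real_cond_exp_intA) (auto simp: emeasure_eq_measure)
    also have "\<dots> = (\<integral>x\<in>B. real_cond_exp M H (\<lambda>x. ?h x * indicator D x) x \<partial>M)"
    proof -
      have "AE x in M. real_cond_exp M H (\<lambda>x. ?h x * indicator D x) x
          = ?h x * real_cond_exp M H (indicator D) x"
        using DM hD by (intro H.real_cond_exp_mult) auto
      then have "AE x in M. x \<in> B \<longrightarrow> real_cond_exp M H (indicator (D \<inter> E)) x
          = real_cond_exp M H (\<lambda>x. ?h x * indicator D x) x"
        using indep[OF D] by eventually_elim (simp add: mult.commute)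
      then show ?thesis
        using BM by (intro set_lebesgue_integral_cong_AE) auto
    qed
    also have "\<dots> = (\<integral>x\<in>B. ?h x * indicator D x \<partial>M)"
      using hD B by (intro H.real_cond_exp_intA[symmetric]) auto
    also have "\<dots> = (\<integral>x\<in>D \<inter> B. ?h x \<partial>M)"
      unfolding set_lebesgue_integral_def by (rule Bochner_Integration.integral_cong) (auto simp: indicator_def)
    finally show ?thesis .
  qed
  have "(\<integral>x\<in>A. indicator E x \<partial>M) = (\<integral>x\<in>A. ?h x \<partial>M)" if "A \<in> sets K" for A
    using pi pow that unfolding gen
  proof (induction rule: sigma_sets_induct_disjoint)
    case (basic A) then show ?case using rect by auto
  next
    case empty show ?case by (simp add: set_lebesgue_integral_def)
  next
    case (compl A)
    have A: "A \<in> events" using compl gen spaces by auto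
    \<comment> \<open>The whole space is itself one of the generating sets, which reduces the
      complement case to a subtraction.\<close>
    have top: "(\<integral>x\<in>space M. indicator E x \<partial>M) = (\<integral>x\<in>space M. ?h x \<partial>M)"
      using rect[of "space M" "space M"] spaces sets.top[of L] sets.top[of H] by simp
    have *: "(\<integral>x\<in>space M - A. g x \<partial>M) = (\<integral>x\<in>space M. g x \<partial>M) - (\<integral>x\<in>A. g x \<partial>M)"
      if "integrable M g" for g :: "'a \<Rightarrow> real"
    proof -
      have si: "set_integrable M S g" if "S \<in> events" for S
        using integrable_mult_indicator[OF that \<open>integrable M g\<close>] by (simp add: set_integrable_def)
      have "(\<integral>x\<in>(space M - A) \<union> A. g x \<partial>M) = (\<integral>x\<in>space M - A. g x \<partial>M) + (\<integral>x\<in>A. g x \<partial>M)"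
        using A by (intro set_integral_Un si) auto
      moreover have "(space M - A) \<union> A = space M" using sets.sets_into_space[OF A] by auto
      ultimately show ?thesis by simp
    qed
    show ?case by (simp add: *[OF intE] *[OF inth] top compl)
  next
    case (union A)
    have A: "A i \<in> events" for i
      using union(2) gen spaces(5) by (metis range_subsetD subsetD)
    have *: "(\<integral>x\<in>(\<Union>i. A i). g x \<partial>M) = (\<Sum>i. \<integral>x\<in>A i. g x \<partial>M)"
      if "integrable M g" for g :: "'a \<Rightarrow> real"
    proof (rule lebesgue_integral_countable_add)
      show "set_integrable M (\<Union>i. A i) g"
        unfolding set_integrable_def using A that by (intro integrable_mult_indicator) auto
    qed (use A union(1) in \<open>auto simp: disjoint_family_on_def\<close>)
    show ?case by (simp add: *[OF intE] *[OF inth] union(3))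
  qed
  then show ?thesis
    by (rule K.real_cond_exp_charact) (use intE inth in \<open>auto intro: measurable_from_subalg[OF assms(4)]\<close>)
qed

end

section \<open>Sigma-algebras generated by sets of coordinates\<close>

lemma space_coord_algebra [simp]: "space (coord_algebra P N A) = space P"
  by (simp add: coord_algebra_def)

locale jointly_distributed =
  fixes V :: "'v set" and N :: "'v \<Rightarrow> 'a measure" and P :: "('v \<Rightarrow> 'a) measure"
  assumes joint: "joint_distribution V N P"
begin

lemma prob_space_P: "prob_space P"
  using joint by (simp add: joint_distribution_def)

sublocale prob_space P by (rule prob_space_P)

lemma sets_P: "sets P = sets (Pi\<^sub>M V N)"
  using joint by (simp add: joint_distribution_def)

lemma measurable_coord_algebra:
  assumes "A \<subseteq> V" "i \<in> A"
  shows "(\<lambda>x. x i) \<in> measurable (coord_algebra P N A) (N i)"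
proof -
  have "(\<lambda>x. restrict x A) \<in> space P \<rightarrow> space (Pi\<^sub>M A N)"
    using assms(1) sets_eq_imp_space_eq[OF sets_P] by (auto simp: space_PiM)
  then have "(\<lambda>x. restrict x A) \<in> measurable (coord_algebra P N A) (Pi\<^sub>M A N)"
    unfolding coord_algebra_def by (rule measurable_vimage_algebra1)
  from measurable_compose[OF this measurable_component_singleton[OF assms(2)]]
  show ?thesis using assms(2) by simp
qed

text \<open>This is the minimality of the generated sigma-algebra. All comparisons of coordinate
  algebras below are reduced by it to the measurability of single coordinates.\<close>

lemma sets_coord_algebra_subset:
  assumes "space K = space P" "\<And>i. i \<in> A \<Longrightarrow> (\<lambda>x. x i) \<in> measurable K (N i)"
  shows "sets (coord_algebra P N A) \<subseteq> sets K"
  unfolding coord_algebra_def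
  using assms(2) by (intro sets_image_in_sets assms(1) measurable_restrict)

lemma subalgebra_coord_algebra:
  assumes "A \<subseteq> V"
  shows "subalgebra P (coord_algebra P N A)"
proof -
  have "(\<lambda>x. x i) \<in> measurable P (N i)" if "i \<in> A" for i
    using assms that
    by (subst measurable_cong_sets[OF sets_P refl]) (auto intro: measurable_component_singleton)
  then show ?thesis
    by (simp add: subalgebra_def sets_coord_algebra_subset)
qed

lemma subalgebra_coord_algebra_mono:
  assumes "A \<subseteq> B" "B \<subseteq> V"
  shows "subalgebra (coord_algebra P N B) (coord_algebra P N A)"
proof -
  have "(\<lambda>x. x i) \<in> measurable (coord_algebra P N B) (N i)" if "i \<in> A" for i
    using assms that by (intro measurable_coord_algebra) auto
  then show ?thesis
    by (simp add: subalgebra_def sets_coord_algebra_subset)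
qed

text \<open>The preimage under a single coordinate is an intersection of the required form with the
  whole space as the other factor. This supplies the hypothesis \<open>gen\<close> of
  \<open>real_cond_exp_indicator_generated\<close>.\<close>

lemma sets_coord_algebra_insert:
  assumes "insert Y S \<subseteq> V"
  shows "sets (coord_algebra P N (insert Y S)) = sigma_sets (space P)
    {D \<inter> B |D B. D \<in> sets (coord_algebra P N {Y}) \<and> B \<in> sets (coord_algebra P N S)}"
    (is "sets ?K = sigma_sets _ ?G")
proof
  have "B \<subseteq> space P" if "B \<in> sets (coord_algebra P N S)" for B
    using sets.sets_into_space[OF that] by simp
  then have G: "?G \<subseteq> Pow (space P)" by blast
  let ?M = "sigma (space P) ?G"
  have "sets ?K \<subseteq> sets ?M"
  proof (rule sets_coord_algebra_subset)
    fix i assume i: "i \<in> insert Y S"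
    show "(\<lambda>x. x i) \<in> measurable ?M (N i)"
    proof (rule measurableI)
      fix x assume "x \<in> space ?M"
      then show "x i \<in> space (N i)"
        using i assms sets_eq_imp_space_eq[OF sets_P] G by (auto simp: space_PiM space_measure_of_conv)
    next
      fix U assume U: "U \<in> sets (N i)"
      let ?X = "(\<lambda>x. x i) -` U \<inter> space P"
      have "?X \<in> ?G"
      proof (cases "i = Y")
        case True
        then have "?X \<in> sets (coord_algebra P N {Y})"
          using measurable_sets[OF measurable_coord_algebra[of "{Y}" Y] U[unfolded True]] assms by simp
        moreover have "space P \<in> sets (coord_algebra P N S)"
          by (metis sets.top space_coord_algebra)
        ultimately show ?thesis by (intro CollectI exI[of _ ?X] exI[of _ "space P"]) auto
      next
        case False
        then have "?X \<in> sets (coord_algebra P N S)"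
          using measurable_sets[OF measurable_coord_algebra[of S i] U] assms i by simp
        moreover have "space P \<in> sets (coord_algebra P N {Y})"
          by (metis sets.top space_coord_algebra)
        ultimately show ?thesis by (intro CollectI exI[of _ "space P"] exI[of _ ?X]) auto
      qed
      then show "(\<lambda>x. x i) -` U \<inter> space ?M \<in> sets ?M"
        using G by (auto simp: space_measure_of_conv)
    qed
  qed (use G in \<open>simp add: space_measure_of_conv\<close>)
  then show "sets ?K \<subseteq> sigma_sets (space P) ?G" using G by simp
  have "sets (coord_algebra P N {Y}) \<subseteq> sets ?K" "sets (coord_algebra P N S) \<subseteq> sets ?K"
    using subalgebra_coord_algebra_mono[of "{Y}" "insert Y S"]
      subalgebra_coord_algebra_mono[of S "insert Y S"] assms
    by (auto simp: subalgebra_def)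
  then have "?G \<subseteq> sets ?K" by auto
  then show "sigma_sets (space P) ?G \<subseteq> sets ?K"
    using sets.sigma_sets_subset[of ?G ?K] by simp
qed

text \<open>Independence of \<open>Y\<close> and \<open>T\<close> given \<open>S\<close> means that
  learning \<open>Y\<close> in addition to \<open>S\<close> leaves the conditional probability of
  each event of the target unchanged almost everywhere.\<close>

lemma cond_prob_energy_if_cond_indep:
  assumes "insert Y S \<subseteq> V" "T \<in> V" "cond_indep P N {Y} {T} S" "E \<in> sets (coord_algebra P N {T})"
  shows "cond_prob_energy E (coord_algebra P N (insert Y S)) = cond_prob_energy E (coord_algebra P N S)"
proof (rule cond_prob_energy_cong,
    rule real_cond_exp_indicator_generated[OF _ _ _ _ sets_coord_algebra_insert[OF assms(1)]])
  show "E \<in> events"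
    using subalgebra_coord_algebra[of "{T}"] assms(2,4) by (auto simp: subalgebra_def)
  show "subalgebra (coord_algebra P N (insert Y S)) (coord_algebra P N S)"
    using assms(1) by (intro subalgebra_coord_algebra_mono) auto
  fix D assume "D \<in> sets (coord_algebra P N {Y})"
  with assms(3,4) show "AE x in P. real_cond_exp P (coord_algebra P N S) (indicator (D \<inter> E)) x =
      real_cond_exp P (coord_algebra P N S) (indicator D) x *
      real_cond_exp P (coord_algebra P N S) (indicator E) x"
    unfolding cond_indep_def by blast
qed (use assms(1) in \<open>simp_all add: subalgebra_coord_algebra\<close>)

text \<open>Equal energies force equal conditional probabilities given \<open>C\<close> and given
  \<open>C'\<close>, and the events of \<open>Y\<close> belong to the algebra of \<open>C'\<close>.
  The larger set may contain further new variables, as happens when fastIAMB adds several at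
  once.\<close>

lemma cond_indep_if_cond_prob_energy:
  assumes "C \<subseteq> C'" "C' \<subseteq> V" "Y \<in> C'" "T \<in> V"
    and eq: "\<And>E. E \<in> sets (coord_algebra P N {T}) \<Longrightarrow>
      cond_prob_energy E (coord_algebra P N C) = cond_prob_energy E (coord_algebra P N C')"
  shows "cond_indep P N {Y} {T} C"
  unfolding cond_indep_def
proof (intro ballI)
  fix D E assume D: "D \<in> sets (coord_algebra P N {Y})" and E: "E \<in> sets (coord_algebra P N {T})"
  have sub: "subalgebra P (coord_algebra P N C')"
      "subalgebra (coord_algebra P N C') (coord_algebra P N C)"
    using assms by (auto intro: subalgebra_coord_algebra subalgebra_coord_algebra_mono)
  have D': "D \<in> sets (coord_algebra P N C')"
    using D subalgebra_coord_algebra_mono[of "{Y}" C'] assms by (auto simp: subalgebra_def)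
  have E': "E \<in> events"
    using subalgebra_coord_algebra[of "{T}"] assms(4) E by (auto simp: subalgebra_def)
  show "AE x in P. real_cond_exp P (coord_algebra P N C) (indicator (D \<inter> E)) x =
      real_cond_exp P (coord_algebra P N C) (indicator D) x *
      real_cond_exp P (coord_algebra P N C) (indicator E) x"
    by (rule real_cond_exp_indicator_Int[OF sub D' E' cond_prob_energy_eq_imp[OF sub E' eq[OF E]]])
qed

text \<open>A counterpart of comparing the conditional entropies of the target given \<open>D\<close> and given \<open>C\<close>
  that makes sense for arbitrary target distributions.\<close>

definition less_informative :: "'v \<Rightarrow> 'v set \<Rightarrow> 'v set \<Rightarrow> bool" where
  "less_informative T C D \<longleftrightarrow>
     (\<forall>E \<in> sets (coord_algebra P N {T}).
        cond_prob_energy E (coord_algebra P N C) \<le> cond_prob_energy E (coord_algebra P N D)) \<and>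
     (\<exists>E \<in> sets (coord_algebra P N {T}).
        cond_prob_energy E (coord_algebra P N C) < cond_prob_energy E (coord_algebra P N D))"

text \<open>Energies are real, and a strict increase among reals does not bound the length of a run.
  Counting the finitely many candidate sets that are strictly more informative turns the comparison
  into a rank in the natural numbers.\<close>

definition uninformedness :: "'v \<Rightarrow> 'v set \<Rightarrow> nat" where
  "uninformedness T C = card {D. D \<subseteq> V - {T} \<and> less_informative T C D}"

lemma uninformedness_remove:
  assumes "C \<subseteq> V - {T}" "T \<in> V" "Y \<in> removable (ci_test N P T) C"
  shows "uninformedness T (C - {Y}) = uninformedness T C"
proof -
  have Y: "insert Y (C - {Y}) = C" "cond_indep P N {Y} {T} (C - {Y})"
    using assms(3) by (auto simp: removable_def ci_test_def)
  have "cond_prob_energy E (coord_algebra P N C) = cond_prob_energy E (coord_algebra P N (C - {Y}))"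
    if "E \<in> sets (coord_algebra P N {T})" for E
    using cond_prob_energy_if_cond_indep[OF _ assms(2) Y(2) that] assms(1) Y(1) by auto
  then show ?thesis
    by (simp add: uninformedness_def less_informative_def cong: ball_cong bex_cong)
qed

text \<open>Monotonicity gives the weak inequalities. If all of them were equalities,
  \<open>Y\<close> would be independent of the target given \<open>C\<close>.\<close>

lemma less_informative_add:
  assumes "C \<subseteq> C'" "C' \<subseteq> V" "T \<in> V" "Y \<in> C'" "\<not> cond_indep P N {Y} {T} C"
  shows "less_informative T C C'"
proof -
  have le: "cond_prob_energy E (coord_algebra P N C) \<le> cond_prob_energy E (coord_algebra P N C')"
    if "E \<in> sets (coord_algebra P N {T})" for E
  proof (rule cond_prob_energy_mono)
    show "E \<in> events"
      using subalgebra_coord_algebra[of "{T}"] assms(3) that by (auto simp: subalgebra_def)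
  qed (use assms(1,2) in \<open>auto intro: subalgebra_coord_algebra subalgebra_coord_algebra_mono\<close>)
  moreover from cond_indep_if_cond_prob_energy[OF assms(1,2,4,3)] assms(5)
  obtain E where "E \<in> sets (coord_algebra P N {T})"
      "cond_prob_energy E (coord_algebra P N C) \<noteq> cond_prob_energy E (coord_algebra P N C')"
    by blast
  ultimately show ?thesis
    unfolding less_informative_def by (metis order_le_less)
qed

lemma less_informative_trans:
  assumes "less_informative T C D" "less_informative T D D'"
  shows "less_informative T C D'"
  using assms unfolding less_informative_def by (meson order_trans order_le_less_trans)

lemma not_less_informative_refl: "\<not> less_informative T C C"
  by (simp add: less_informative_def)

text \<open>By transitivity every set counted for \<open>C'\<close> is counted for \<open>C\<close>.
  The set \<open>C'\<close> itself is counted for \<open>C\<close> but not for \<open>C'\<close>, so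
  the count drops.\<close>

lemma uninformedness_add:
  assumes "finite V" "T \<in> V" "C \<subseteq> C'" "C' \<subseteq> V - {T}" "Y \<in> C'"
    and "Y \<in> dependents V T (ci_test N P T) C"
  shows "uninformedness T C' < uninformedness T C"
  unfolding uninformedness_def
proof (rule psubset_card_mono)
  show "finite {D. D \<subseteq> V - {T} \<and> less_informative T C D}"
    using assms(1) by simp
  have "less_informative T C C'"
    using assms by (intro less_informative_add[of _ _ _ Y]) (auto simp: dependents_def ci_test_def)
  then show "{D. D \<subseteq> V - {T} \<and> less_informative T C' D} \<subset> {D. D \<subseteq> V - {T} \<and> less_informative T C D}"
    using less_informative_trans[of T C C'] not_less_informative_refl[of T C'] assms(4) by blast
qed

end

section \<open>The algorithms with a blanket oracle\<close>

text \<open>Guarantees that MBC-CSP can order its initial \<open>adj\<close>, so that its start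
  configuration is not stuck.\<close>

lemma finite_ex_sorted_list:
  fixes key :: "'a \<Rightarrow> 'b::linorder"
  assumes "finite D"
  obtains L where "set L = D" "distinct L" "sorted_wrt (\<lambda>u v. key u \<le> key v) L"
proof -
  obtain L where "set L = D" "distinct L" using assms finite_distinct_list by blast
  then show ?thesis
    by (intro that[of "sort_key key L"] sorted_sort_key[unfolded sorted_map]) auto
qed

text \<open>An infinite run would be an infinite descending chain of \<open>W\<close>. The
  hypothesis \<open>stuck\<close> combines absence of deadlock with correctness of the returned
  set.\<close>

lemma always_returnsI:
  assumes "Inv c"
    and step: "\<And>c c'. Inv c \<Longrightarrow> step c c' \<Longrightarrow> Inv c' \<and> (c', c) \<in> W"
    and "wf W"
    and stuck: "\<And>c. Inv c \<Longrightarrow> (\<nexists>c'. step c c') \<Longrightarrow> c = Returned R"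
  shows "always_returns step c R"
  unfolding always_returns_def
proof (intro conjI allI impI notI; (elim exE conjE)?)
  fix run assume run: "run 0 = c" "\<forall>i. step (run i) (run (Suc i))"
  have "Inv (run i)" for i
    by (induction i) (use run \<open>Inv c\<close> step in auto)
  then have "(run (Suc i), run i) \<in> W" for i
    using run step by blast
  then show False
    using \<open>wf W\<close> unfolding wf_iff_no_infinite_down_chain by blast
next
  fix c' assume "step\<^sup>*\<^sup>* c c'" and "\<nexists>c''. step c' c''"
  from this(1) have "Inv c'"
    by induction (use \<open>Inv c\<close> step in auto)
  then show "c' = Returned R"
    using stuck \<open>\<nexists>c''. step c' c''\<close> by blast
qed

text \<open>\<open>A\<close> collects the neighbours, parents and children of the target, \<open>B - A\<close> the remaining
  members of the Markov blanket.  The rank \<open>r\<close> plays the role of the conditional entropy of the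
  target given the candidate set.\<close>

locale blanket_test =
  fixes V :: "'v set" and T :: 'v and I :: "'v \<Rightarrow> 'v set \<Rightarrow> bool"
    and A B :: "'v set" and r :: "'v set \<Rightarrow> nat"
  assumes finite_V: "finite V"
    and B_subset: "B \<subseteq> V - {T}"
    and A_subset: "A \<subseteq> B"
    and adjacent_dependent: "Y \<in> A \<Longrightarrow> S \<subseteq> V - {T, Y} \<Longrightarrow> \<not> I Y S"
    and spouse_dependent: "Y \<in> B - A \<Longrightarrow> \<exists>w\<in>A. \<forall>S \<subseteq> V - {T, Y}. w \<in> S \<longrightarrow> \<not> I Y S"
    and blanket_separates: "B \<subseteq> S \<Longrightarrow> S \<subseteq> V - {T} \<Longrightarrow> Y \<in> V - {T} - S \<Longrightarrow> I Y S"
    and rank_remove: "C \<subseteq> V - {T} \<Longrightarrow> Y \<in> removable I C \<Longrightarrow> r (C - {Y}) = r C"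
    and rank_add: "C \<subseteq> C' \<Longrightarrow> C' \<subseteq> V - {T} \<Longrightarrow> Y \<in> C' \<Longrightarrow> Y \<in> dependents V T I C \<Longrightarrow> r C' < r C"
begin

section \<open>Candidate sets and their relation to the blanket\<close>

lemma dependents_subset: "dependents V T I C \<subseteq> V - {T}"
  by (auto simp: dependents_def)

lemma finite_candidates: "C \<subseteq> V - {T} \<Longrightarrow> finite C"
  using finite_V by (auto intro: finite_subset)

lemma card_remove_less:
  assumes "C \<subseteq> V - {T}" "Y \<in> removable I C"
  shows "card (C - {Y}) < card C"
  using assms by (intro card_Diff1_less finite_candidates) (auto simp: removable_def)

lemma card_candidates_le: "C \<subseteq> V - {T} \<Longrightarrow> card C \<le> card V"
  using finite_V by (auto intro: card_mono)

lemma card_candidates_less: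
  assumes "C \<subseteq> V - {T}" "Y \<in> V - (C \<union> {T})"
  shows "card V - card (insert Y C) < card V - card C"
  using assms finite_candidates[of C] card_candidates_le[of "insert Y C"] by auto

text \<open>Two stages: members of \<open>A\<close> are dependent given anything, so all of them are
  in \<open>C\<close>. Then \<open>C\<close> contains the witness \<open>w\<close> of each remaining
  member, which is therefore dependent given \<open>C\<close> unless it is already there.\<close>

lemma blanket_subset_if_no_dependents:
  assumes "C \<subseteq> V - {T}" "dependents V T I C = {}"
  shows "B \<subseteq> C"
proof -
  have dep: "Y \<in> C" if "Y \<in> V - {T}" "\<not> I Y C" for Y
    using assms(2) that by (auto simp: dependents_def)
  have A: "A \<subseteq> C"
  proof
    fix Y assume "Y \<in> A"
    then show "Y \<in> C"
      using adjacent_dependent[of Y C] dep[of Y] assms(1) A_subset B_subset by blast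
  qed
  show ?thesis
  proof
    fix Y assume Y: "Y \<in> B"
    show "Y \<in> C"
    proof (cases "Y \<in> A")
      case False
      with Y obtain w where "w \<in> A" "\<And>S. S \<subseteq> V - {T, Y} \<Longrightarrow> w \<in> S \<Longrightarrow> \<not> I Y S"
        using spouse_dependent by blast
      then show ?thesis
        using dep[of Y] A assms(1) Y B_subset by blast
    qed (use A in auto)
  qed
qed

text \<open>No blanket member is removable from such a \<open>C\<close>: members of \<open>A\<close>
  are always dependent, and the witness \<open>w\<close> of any other member lies in
  \<open>A\<close>, hence differs from \<open>Y\<close> and is still in
  \<open>C - {Y}\<close>.\<close>

lemma blanket_subset_remove:
  assumes "C \<subseteq> V - {T}" "B \<subseteq> C" "Y \<in> removable I C"
  shows "B \<subseteq> C - {Y}"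
proof -
  have Y: "Y \<in> C" "I Y (C - {Y})" using assms(3) by (auto simp: removable_def)
  have C: "C - {Y} \<subseteq> V - {T, Y}" using assms(1) by auto
  have "Y \<notin> A" using adjacent_dependent C Y by blast
  moreover have False if "Y \<in> B" "Y \<notin> A"
  proof -
    from that obtain w where "w \<in> A" "\<And>S. S \<subseteq> V - {T, Y} \<Longrightarrow> w \<in> S \<Longrightarrow> \<not> I Y S"
      using spouse_dependent by blast
    then show False
      using C Y that assms(2) A_subset by (metis Diff_iff singletonD subsetD)
  qed
  ultimately show ?thesis using assms(2) by blast
qed

lemma blanket_if_no_removable:
  assumes "C \<subseteq> V - {T}" "B \<subseteq> C" "removable I C = {}"
  shows "C = B"
proof (rule ccontr)
  assume "C \<noteq> B"
  with assms(2) obtain Y where Y: "Y \<in> C" "Y \<notin> B" by blast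
  then have "I Y (C - {Y})"
    using assms(1,2) by (intro blanket_separates) auto
  with Y assms(3) show False by (auto simp: removable_def)
qed

text \<open>Growing and shrinking each happen only once, so the phase followed by a cardinality
  suffices for termination, without the rank.\<close>

theorem gs_returns_blanket: "always_returns (gs_step V T I) (Running (Grow, {})) B"
proof -
  let ?inv = "\<lambda>c. case c of Running (Grow, C) \<Rightarrow> C \<subseteq> V - {T}
    | Running (Shrink, C) \<Rightarrow> C \<subseteq> V - {T} \<and> B \<subseteq> C | Returned C \<Rightarrow> C = B"
  let ?m1 = "\<lambda>c. case c of Running (Grow, C) \<Rightarrow> 2 | Running (Shrink, C) \<Rightarrow> 1 | Returned C \<Rightarrow> (0 :: nat)"
  let ?m2 = "\<lambda>c. case c of Running (Grow, C) \<Rightarrow> card V - card C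
    | Running (Shrink, C) \<Rightarrow> card C | Returned C \<Rightarrow> 0"
  show ?thesis
  proof (rule always_returnsI[where Inv = ?inv and W = "measures [?m1, ?m2]"])
    fix c c' assume inv: "?inv c" and "gs_step V T I c c'"
    from this(2) show "?inv c' \<and> (c', c) \<in> measures [?m1, ?m2]"
    proof cases
      case (gs_add Y C)
      then show ?thesis
        using inv card_candidates_less[of C Y] by (auto simp: dependents_def)
    next
      case (gs_grown C)
      then show ?thesis
        using inv blanket_subset_if_no_dependents by auto
    next
      case (gs_remove Y C)
      then show ?thesis
        using inv card_remove_less blanket_subset_remove by auto
    next
      case (gs_return C)
      then show ?thesis
        using inv blanket_if_no_removable by auto
    qed
  next
    fix c assume inv: "?inv c" and stuck: "\<nexists>c'. gs_step V T I c c'"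
    show "c = Returned B"
    proof (cases c)
      case (Running s)
      obtain p C where s: "s = (p, C)" by (cases s)
      have False
        using stuck unfolding Running s
        by (cases p) (blast intro: gs_step.intros)+
      then show ?thesis ..
    qed (use inv in auto)
  qed auto
qed

theorem fast_iamb_returns_blanket:
  "always_returns (fast_iamb_step V T I) (Running (Grow, {})) B"
proof -
  let ?inv = "\<lambda>c. case c of Running (_, C) \<Rightarrow> C \<subseteq> V - {T} | Returned C \<Rightarrow> C = B"
  let ?m1 = "\<lambda>c. case c of Running _ \<Rightarrow> 1 | Returned C \<Rightarrow> (0 :: nat)"
  let ?m2 = "\<lambda>c. case c of Running (_, C) \<Rightarrow> r C | Returned C \<Rightarrow> 0"
  \<comment> \<open>Growing by at least one variable lowers the rank, so such \<open>Grow\<close>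
    configurations may take the least values here and in \<open>?m4\<close>, which makes the return
    from \<open>Shrink\<close> to \<open>Grow\<close> decrease. A \<open>Grow\<close> configuration
    without dependents can only be the initial one; its step to \<open>Shrink\<close> changes no set
    and is paid for by the value 2 in \<open>?m4\<close>.\<close>
  let ?m3 = "\<lambda>c. case c of Running (Grow, C) \<Rightarrow> if dependents V T I C = {} then card C else 0
    | Running (Shrink, C) \<Rightarrow> card C | Returned C \<Rightarrow> 0"
  let ?m4 = "\<lambda>c. case c of Running (Grow, C) \<Rightarrow> if dependents V T I C = {} then 2 else 0
    | Running (Shrink, C) \<Rightarrow> 1 | Returned C \<Rightarrow> (0 :: nat)"
  show ?thesis
  proof (rule always_returnsI[where Inv = ?inv and W = "measures [?m1, ?m2, ?m3, ?m4]"])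
    fix c c' assume inv: "?inv c" and "fast_iamb_step V T I c c'"
    from this(2) show "?inv c' \<and> (c', c) \<in> measures [?m1, ?m2, ?m3, ?m4]"
    proof cases
      case (fast_add C)
      let ?D = "dependents V T I C"
      have C: "C \<union> ?D \<subseteq> V - {T}" using fast_add inv dependents_subset[of C] by auto
      show ?thesis
      proof (cases "?D = {}")
        case False
        then obtain Y where "Y \<in> ?D" by blast
        then have "r (C \<union> ?D) < r C" by (intro rank_add[OF _ C]) auto
        then show ?thesis using fast_add C by auto
      qed (use fast_add C in auto)
    next
      case (fast_remove Y C)
      then show ?thesis
        using inv card_remove_less rank_remove by auto
    next
      case (fast_repeat C)
      then show ?thesis using inv by auto
    next
      case (fast_return C)
      then show ?thesis
        using inv blanket_if_no_removable blanket_subset_if_no_dependents by auto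
    qed
  next
    fix c assume inv: "?inv c" and stuck: "\<nexists>c'. fast_iamb_step V T I c c'"
    show "c = Returned B"
    proof (cases c)
      case (Running s)
      obtain p C where s: "s = (p, C)" by (cases s)
      have False
        using stuck unfolding Running s
        by (cases p) (blast intro: fast_iamb_step.intros)+
      then show ?thesis ..
    qed (use inv in auto)
  qed auto
qed

text \<open>Additions lower the rank; removals keep it and lower the cardinality. The invariant need
  not contain the blanket, since the guard of the return step excludes both dependents and removable
  candidates.\<close>

theorem fdr_iamb_returns_blanket: "always_returns (fdr_iamb_step V T I) (Running {}) B"
proof -
  let ?inv = "\<lambda>c. case c of Running C \<Rightarrow> C \<subseteq> V - {T} | Returned C \<Rightarrow> C = B"
  let ?m1 = "\<lambda>c. case c of Running _ \<Rightarrow> 1 | Returned C \<Rightarrow> (0 :: nat)"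
  let ?m2 = "\<lambda>c. case c of Running C \<Rightarrow> r C | Returned C \<Rightarrow> 0"
  let ?m3 = "\<lambda>c. case c of Running C \<Rightarrow> card C | Returned C \<Rightarrow> 0"
  show ?thesis
  proof (rule always_returnsI[where Inv = ?inv and W = "measures [?m1, ?m2, ?m3]"])
    fix c c' assume inv: "?inv c" and "fdr_iamb_step V T I c c'"
    from this(2) show "?inv c' \<and> (c', c) \<in> measures [?m1, ?m2, ?m3]"
    proof cases
      case (fdr_remove Y C)
      then show ?thesis
        using inv card_remove_less rank_remove by auto
    next
      case (fdr_add C Y)
      have "insert Y C \<subseteq> V - {T}" using fdr_add inv dependents_subset[of C] by auto
      with fdr_add show ?thesis using rank_add[of C "insert Y C" Y] by auto
    next
      case (fdr_return C)
      then show ?thesis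
        using inv blanket_if_no_removable blanket_subset_if_no_dependents by auto
    qed
  next
    fix c assume inv: "?inv c" and stuck: "\<nexists>c'. fdr_iamb_step V T I c c'"
    show "c = Returned B"
    proof (cases c)
      case (Running C)
      have False
        using stuck unfolding Running by (blast intro: fdr_iamb_step.intros)
      then show ?thesis ..
    qed (use inv in auto)
  qed auto
qed

section \<open>MBC-CSP and its separating sets\<close>

definition sepsets_ok :: "'v list \<Rightarrow> ('v \<Rightarrow> 'v set option) \<Rightarrow> bool" where
  "sepsets_ok L sep \<longleftrightarrow> distinct L \<and> set L \<subseteq> V - {T} \<and> A \<subseteq> set L \<and>
     (\<forall>v \<in> V - {T} - set L. \<exists>S. sep v = Some S \<and> S \<subseteq> V - {T, v} \<and> I v S)"

text \<open>A vertex found independent given some set cannot belong to \<open>A\<close>, so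
  \<open>adj\<close> never loses a neighbour, parent or child of the target.\<close>

lemma sepsets_ok_remove:
  assumes "sepsets_ok L sep" "S \<subseteq> set L - {v}" "I v S"
  shows "sepsets_ok (remove1 v L) (sep(v \<mapsto> S))"
proof -
  have "S \<subseteq> V - {T, v}"
    using assms(1,2) by (auto simp: sepsets_ok_def)
  with assms adjacent_dependent[of v S] show ?thesis
    unfolding sepsets_ok_def by (auto simp: set_remove1_eq)
qed

text \<open>A blanket member outside \<open>adj\<close> has a witness \<open>w\<close> in
  \<open>A\<close>, hence in \<open>adj\<close>. Its recorded set separates it from the target, and
  adding \<open>w\<close> destroys the separation, which is the criterion of Step 2. Extra vertices
  that pass this criterion are removed by the final shrinking.\<close>

lemma blanket_subset_adj_spouses:
  assumes "sepsets_ok L sep"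
  shows "B \<subseteq> set L \<union> mbc_spouses V T I (set L) sep"
proof
  fix v assume v: "v \<in> B"
  show "v \<in> set L \<union> mbc_spouses V T I (set L) sep"
  proof (cases "v \<in> set L")
    case False
    with assms v obtain S where S: "sep v = Some S" "S \<subseteq> V - {T, v}" "I v S"
      using B_subset unfolding sepsets_ok_def by blast
    have AL: "A \<subseteq> set L" "set L \<subseteq> V - {T}" using assms by (auto simp: sepsets_ok_def)
    with False v obtain w where w: "w \<in> A" "\<And>S. S \<subseteq> V - {T, v} \<Longrightarrow> w \<in> S \<Longrightarrow> \<not> I v S"
      using spouse_dependent[of v] by blast
    have "\<not> I v (S \<union> {w})"
      using S AL False w by (intro w(2)) auto
    then show ?thesis
      using S w(1) v AL False B_subset unfolding mbc_spouses_def by blast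
  qed simp
qed

theorem mbc_csp_returns_blanket: "always_returns (mbc_csp_step V T corr I) (Running Start) B"
proof -
  \<comment> \<open>The bound on \<open>k\<close> during a visit comes from the guard
    \<open>k \<le> length L\<close> of the round. It keeps the truncated difference in
    \<open>?m2\<close> positive, so that the next round makes it decrease.\<close>
  let ?inv = "\<lambda>c. case c of Running Start \<Rightarrow> True | Running (Round k L sep) \<Rightarrow> sepsets_ok L sep
    | Running (Visit k q L sep) \<Rightarrow> sepsets_ok L sep \<and> k \<le> card V
    | Running (Final_Shrink C) \<Rightarrow> C \<subseteq> V - {T} \<and> B \<subseteq> C | Returned C \<Rightarrow> C = B"
  let ?m1 = "\<lambda>c. case c of Running Start \<Rightarrow> 3 | Running (Round k L sep) \<Rightarrow> 2
    | Running (Visit k q L sep) \<Rightarrow> 2 | Running (Final_Shrink C) \<Rightarrow> 1 | Returned C \<Rightarrow> (0 :: nat)"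
  let ?m2 = "\<lambda>c. case c of Running Start \<Rightarrow> 0 | Running (Round k L sep) \<Rightarrow> Suc (card V) - k
    | Running (Visit k q L sep) \<Rightarrow> Suc (card V) - k | Running (Final_Shrink C) \<Rightarrow> card C | Returned C \<Rightarrow> 0"
  \<comment> \<open>The value for \<open>Round\<close> exceeds the length of the queue with which
    the visit of the same round starts.\<close>
  let ?m3 = "\<lambda>c. case c of Running (Round k L sep) \<Rightarrow> Suc (card V)
    | Running (Visit k q L sep) \<Rightarrow> length q | _ \<Rightarrow> 0"
  have len: "length L \<le> card V" if "sepsets_ok L sep" for L sep
    using that card_candidates_le[of "set L"] by (auto simp: sepsets_ok_def distinct_card)
  show ?thesis
  proof (rule always_returnsI[where Inv = ?inv and W = "measures [?m1, ?m2, ?m3]"])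
    fix c c' assume inv: "?inv c" and "mbc_csp_step V T corr I c c'"
    from this(2) show "?inv c' \<and> (c', c) \<in> measures [?m1, ?m2, ?m3]"
    proof cases
      case (mbc_start L)
      \<comment> \<open>The initial map records the empty set for exactly the vertices of
        \<open>V - {T}\<close> left out of \<open>L\<close>, so only this inclusion needs an
        argument.\<close>
      have "A \<subseteq> set L"
        using mbc_start(3) A_subset B_subset adjacent_dependent[of _ "{}"] by auto
      then show ?thesis
        using mbc_start by (auto simp: sepsets_ok_def)
    next
      case (mbc_round k L sep)
      then show ?thesis using inv len[of L sep] by auto
    next
      case (mbc_separated S L v k q sep)
      then show ?thesis using inv sepsets_ok_remove by auto
    next
      case (mbc_kept L v k q sep)
      then show ?thesis using inv by auto
    next
      case (mbc_round_done k L sep)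
      then show ?thesis using inv by auto
    next
      case (mbc_candidates k L sep)
      have "mbc_spouses V T I (set L) sep \<subseteq> V - {T}" by (auto simp: mbc_spouses_def)
      then show ?thesis
        using mbc_candidates inv blanket_subset_adj_spouses[of L sep] by (auto simp: sepsets_ok_def)
    next
      case (mbc_remove Y C)
      then show ?thesis
        using inv card_remove_less blanket_subset_remove by auto
    next
      case (mbc_return C)
      then show ?thesis
        using inv blanket_if_no_removable by auto
    qed
  next
    fix c assume inv: "?inv c" and stuck: "\<nexists>c'. mbc_csp_step V T corr I c c'"
    show "c = Returned B"
    proof (cases c)
      case (Running s)
      have False
      proof (cases s)
        case Start
        have "finite {v \<in> V - {T}. \<not> I v {}}" using finite_V by auto
        then obtain L where "set L = {v \<in> V - {T}. \<not> I v {}}" "distinct L"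
            "sorted_wrt (\<lambda>u v. corr T u \<le> corr T v) L"
          by (rule finite_ex_sorted_list)
        then show False
          using stuck mbc_start[of L] unfolding Running Start by blast
      next
        case (Round k L sep)
        show False
        proof (cases "k \<le> length L")
          case True
          from mbc_round[OF True] stuck show False unfolding Running Round by blast
        next
          case False
          then have "k > length L" by simp
          from mbc_candidates[OF this] stuck show False unfolding Running Round by blast
        qed
      next
        case (Visit k q L sep)
        show False
        proof (cases q)
          case Nil
          show False
            using stuck mbc_round_done[of V T corr I k L sep] unfolding Running Visit Nil by blast
        next
          case (Cons v q')
          show False
          proof (cases "\<exists>S. S \<subseteq> set L - {v} \<and> card S = k \<and> I v S")
            case True
            then obtain S where "S \<subseteq> set L - {v}" "card S = k" "I v S" by blast
            from mbc_separated[where I = I and L = L and v = v, OF this] stuck show False unfolding Running Visit Cons by blast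
          next
            case False
            from mbc_kept[where I = I and L = L and v = v, OF False] stuck show False unfolding Running Visit Cons by blast
          qed
        qed
      next
        case (Final_Shrink C)
        show False
          using stuck mbc_remove[of _ I C] mbc_return[of I C] unfolding Running Final_Shrink by blast
      qed
      then show ?thesis ..
    qed (use inv in auto)
  qed auto
qed

end

section \<open>IAMB and interIAMB, guided by an association measure\<close>

locale blanket_test_with_measure = blanket_test V T I A B r
  for V :: "'v set" and T I A B r +
  fixes f :: "'v \<Rightarrow> 'v \<Rightarrow> 'v set \<Rightarrow> ereal"
  assumes assoc: "C \<subseteq> V - {T} \<Longrightarrow> Y \<in> V - (C \<union> {T}) \<Longrightarrow> f Y T C \<ge> 0 \<and> (f Y T C = 0 \<longleftrightarrow> I Y C)"
begin

lemma best_candidate_in: "best_candidate V T f C Y \<Longrightarrow> Y \<in> V - (C \<union> {T})"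
  by (auto simp: best_candidate_def is_arg_max_def)

lemma best_candidate_dependent:
  "best_candidate V T f C Y \<Longrightarrow> \<not> I Y C \<Longrightarrow> Y \<in> dependents V T I C"
  using best_candidate_in[of C Y] by (simp add: dependents_def)

text \<open>If the maximum of the nonnegative association is zero, all its values are zero. One
  independent best candidate therefore certifies that growing is complete.\<close>

lemma no_dependents_if_best_independent:
  assumes "C \<subseteq> V - {T}" "best_candidate V T f C Y" "I Y C"
  shows "dependents V T I C = {}"
proof -
  have "f Y T C = 0"
    using assoc[OF assms(1) best_candidate_in[OF assms(2)]] assms(3) by simp
  then have "f Z T C = 0" if "Z \<in> V - (C \<union> {T})" for Z
    using assms(2) that assoc[OF assms(1) that]
    by (auto simp: best_candidate_def is_arg_max_def not_less)
  then show ?thesis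
    using assoc[OF assms(1)] by (auto simp: dependents_def)
qed

lemma no_dependents_if_exhausted: "V - (C \<union> {T}) = {} \<Longrightarrow> dependents V T I C = {}"
  by (auto simp: dependents_def)

lemma ex_best_candidate:
  assumes "V - (C \<union> {T}) \<noteq> {}"
  obtains Y where "best_candidate V T f C Y"
proof -
  let ?D = "V - (C \<union> {T})"
  have fin: "finite ?D" using finite_V by simp
  then have "Max ((\<lambda>Z. f Z T C) ` ?D) \<in> (\<lambda>Z. f Z T C) ` ?D"
    using assms by (intro Max_in) auto
  then obtain Y where Y: "Max ((\<lambda>Z. f Z T C) ` ?D) = f Y T C" "Y \<in> ?D" by (rule imageE)
  have "f Z T C \<le> f Y T C" if "Z \<in> ?D" for Z
    unfolding Y(1)[symmetric] using that fin by (intro Max_ge) auto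
  with Y(2) have "best_candidate V T f C Y"
    unfolding best_candidate_def is_arg_max_def by (meson not_less)
  then show ?thesis by (rule that)
qed

theorem iamb_returns_blanket: "always_returns (iamb_step V T f I) (Running (Grow, {})) B"
proof -
  let ?inv = "\<lambda>c. case c of Running (Grow, C) \<Rightarrow> C \<subseteq> V - {T}
    | Running (Shrink, C) \<Rightarrow> C \<subseteq> V - {T} \<and> B \<subseteq> C | Returned C \<Rightarrow> C = B"
  let ?m1 = "\<lambda>c. case c of Running (Grow, C) \<Rightarrow> 2 | Running (Shrink, C) \<Rightarrow> 1 | Returned C \<Rightarrow> (0 :: nat)"
  let ?m2 = "\<lambda>c. case c of Running (Grow, C) \<Rightarrow> card V - card C
    | Running (Shrink, C) \<Rightarrow> card C | Returned C \<Rightarrow> 0"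
  show ?thesis
  proof (rule always_returnsI[where Inv = ?inv and W = "measures [?m1, ?m2]"])
    fix c c' assume inv: "?inv c" and "iamb_step V T f I c c'"
    from this(2) show "?inv c' \<and> (c', c) \<in> measures [?m1, ?m2]"
    proof cases
      case (iamb_add C Y)
      then show ?thesis
        using inv card_candidates_less[of C Y] best_candidate_in[of C Y] by auto
    next
      case (iamb_grown C Y)
      then show ?thesis
        using inv blanket_subset_if_no_dependents no_dependents_if_best_independent by auto
    next
      case (iamb_exhausted C)
      then show ?thesis
        using inv blanket_subset_if_no_dependents no_dependents_if_exhausted by auto
    next
      case (iamb_remove Y C)
      then show ?thesis
        using inv card_remove_less blanket_subset_remove by auto
    next
      case (iamb_return C)
      then show ?thesis
        using inv blanket_if_no_removable by auto
    qed
  next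
    fix c assume inv: "?inv c" and stuck: "\<nexists>c'. iamb_step V T f I c c'"
    show "c = Returned B"
    proof (cases c)
      case (Running s)
      obtain p C where s: "s = (p, C)" by (cases s)
      have False
      proof (cases p)
        case Grow
        show False
        proof (cases "V - (C \<union> {T}) = {}")
          case True
          then show False using stuck iamb_exhausted[OF True] unfolding Running s Grow by blast
        next
          case False
          then obtain Y where "best_candidate V T f C Y" by (rule ex_best_candidate)
          then show False
            using stuck iamb_add[of V T f C Y] iamb_grown[of V T f C Y] unfolding Running s Grow by blast
        qed
      next
        case Shrink
        show False
          using stuck iamb_remove[of _ I C] iamb_return[of I C] unfolding Running s Shrink by blast
      qed
      then show ?thesis ..
    qed (use inv in auto)
  qed auto
qed

text \<open>Additions lower the rank, removals lower the cardinality at equal rank, and the passage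
  from \<open>Shrink\<close> back to \<open>Grow\<close> is paid for by the phase. The invariant of
  \<open>Grow\<close> remembers that shrinking is complete, which is needed when the set is returned
  from that phase.\<close>

theorem inter_iamb_returns_blanket: "always_returns (inter_iamb_step V T f I) (Running (Grow, {})) B"
proof -
  let ?inv = "\<lambda>c. case c of Running (Grow, C) \<Rightarrow> C \<subseteq> V - {T} \<and> removable I C = {}
    | Running (Shrink, C) \<Rightarrow> C \<subseteq> V - {T} | Returned C \<Rightarrow> C = B"
  let ?m1 = "\<lambda>c. case c of Running _ \<Rightarrow> 1 | Returned C \<Rightarrow> (0 :: nat)"
  let ?m2 = "\<lambda>c. case c of Running (_, C) \<Rightarrow> r C | Returned C \<Rightarrow> 0"
  let ?m3 = "\<lambda>c. case c of Running (_, C) \<Rightarrow> card C | Returned C \<Rightarrow> 0"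
  let ?m4 = "\<lambda>c. case c of Running (Shrink, C) \<Rightarrow> 1 | _ \<Rightarrow> (0 :: nat)"
  show ?thesis
  proof (rule always_returnsI[where Inv = ?inv and W = "measures [?m1, ?m2, ?m3, ?m4]"])
    fix c c' assume inv: "?inv c" and "inter_iamb_step V T f I c c'"
    from this(2) show "?inv c' \<and> (c', c) \<in> measures [?m1, ?m2, ?m3, ?m4]"
    proof cases
      case (inter_add C Y)
      have "insert Y C \<subseteq> V - {T}" using inter_add inv best_candidate_in[of C Y] by auto
      with inter_add show ?thesis
        using rank_add[of C "insert Y C" Y] best_candidate_dependent[of C Y] by auto
    next
      case (inter_remove Y C)
      then show ?thesis
        using inv card_remove_less rank_remove by auto
    next
      case (inter_shrunk C)
      then show ?thesis using inv by auto
    next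
      case (inter_return C Y)
      then show ?thesis
        using inv blanket_subset_if_no_dependents no_dependents_if_best_independent
          blanket_if_no_removable by auto
    next
      case (inter_exhausted C)
      then show ?thesis
        using inv blanket_subset_if_no_dependents no_dependents_if_exhausted
          blanket_if_no_removable by auto
    qed
  next
    fix c assume inv: "?inv c" and stuck: "\<nexists>c'. inter_iamb_step V T f I c c'"
    show "c = Returned B"
    proof (cases c)
      case (Running s)
      obtain p C where s: "s = (p, C)" by (cases s)
      have False
      proof (cases p)
        case Grow
        show False
        proof (cases "V - (C \<union> {T}) = {}")
          case True
          then show False using stuck inter_exhausted[OF True] unfolding Running s Grow by blast
        next
          case False
          then obtain Y where "best_candidate V T f C Y" by (rule ex_best_candidate)
          then show False
            using stuck inter_add[of V T f C Y] inter_return[of V T f C Y] unfolding Running s Grow by blast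
        qed
      next
        case Shrink
        show False
          using stuck inter_remove[of _ I C] inter_shrunk[of I C] unfolding Running s Shrink by blast
      qed
      then show ?thesis ..
    qed (use inv in auto)
  \<comment> \<open>The run starts in \<open>Grow\<close>, where the invariant holds because nothing
    can be removed from the empty set.\<close>
  qed (auto simp: removable_def)
qed

end

section \<open>Correctness\<close>

theorem theorem3:
  fixes G :: "'v mixed_graph"
    and N :: "'v \<Rightarrow> 'a measure"
    and P :: "('v \<Rightarrow> 'a) measure"
    and f :: "'v \<Rightarrow> 'v \<Rightarrow> 'v set \<Rightarrow> ereal"
    and corr :: "'v \<Rightarrow> 'v \<Rightarrow> real"
    and T :: 'v
  assumes "lwf_chain_graph G"
    and "joint_distribution (verts G) N P"
    and "global_markov G N P"
    and "faithful G N P"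
    and "association_measure (verts G) N P f"
    and "T \<in> verts G"
  shows "always_returns (gs_step (verts G) T (ci_test N P T))
           (Running (Grow, {})) (Mb G T) \<and>
         always_returns (iamb_step (verts G) T f (ci_test N P T))
           (Running (Grow, {})) (Mb G T) \<and>
         always_returns (mbc_csp_step (verts G) T corr (ci_test N P T))
           (Running Start) (Mb G T) \<and>
         always_returns (fast_iamb_step (verts G) T (ci_test N P T))
           (Running (Grow, {})) (Mb G T) \<and>
         always_returns (inter_iamb_step (verts G) T f (ci_test N P T))
           (Running (Grow, {})) (Mb G T) \<and>
         always_returns (fdr_iamb_step (verts G) T (ci_test N P T))
           (Running {}) (Mb G T)"
proof -
  let ?V = "verts G" and ?I = "ci_test N P T" and ?A = "bd G T \<union> ch G T"
  note simple = assms(1)[unfolded lwf_chain_graph_def, THEN conjunct1]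
  have finite: "finite ?V" using simple by (simp add: simple_mixed_graph_def)
  have Mb: "Mb G T \<subseteq> ?V - {T}" by (rule Mb_subset[OF simple])
  interpret D: jointly_distributed ?V N P by unfold_locales fact
  \<comment> \<open>The Markov property and faithfulness together make each test answer equivalent
    to c-separation, so that everything below is a question about the graph.\<close>
  have ci: "?I Y S \<longleftrightarrow> c_separates G S {Y} {T}" if Y: "Y \<in> ?V - {T}" and S: "S \<subseteq> ?V - {T, Y}" for Y S
  proof
    assume "?I Y S"
    moreover have "Y \<noteq> T \<and> S \<subseteq> ?V - {Y, T}" using Y S by auto
    ultimately show "c_separates G S {Y} {T}"
      using assms(4)[unfolded faithful_def, rule_format, of Y T S] assms(6) Y
      by (auto simp: ci_test_def)
  next
    assume "c_separates G S {Y} {T}"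
    moreover have "{Y} \<subseteq> ?V \<and> {T} \<subseteq> ?V \<and> S \<subseteq> ?V \<and> {Y} \<inter> {T} = {} \<and> {Y} \<inter> S = {} \<and> {T} \<inter> S = {}"
      using Y S assms(6) by auto
    ultimately show "?I Y S"
      using assms(3)[unfolded global_markov_def, rule_format, of "{Y}" "{T}" S]
      by (simp add: ci_test_def)
  qed
  \<comment> \<open>The members of the blanket outside \<open>?A\<close> all come from
    \<open>csp G T\<close>; the witness required for them is the child of \<open>T\<close> provided
    by \<open>not_c_separates_csp\<close>.\<close>
  interpret blanket_test_with_measure ?V T ?I ?A "Mb G T" "D.uninformedness T" f
  proof
    show "finite ?V" "Mb G T \<subseteq> ?V - {T}" "?A \<subseteq> Mb G T"
      using finite Mb by (auto simp: Mb_def)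
    show "\<not> ?I Y S" if "Y \<in> ?A" "S \<subseteq> ?V - {T, Y}" for Y S
    proof -
      have "Y \<in> ?V - {T}" using that(1) Mb by (auto simp: Mb_def)
      then show ?thesis
        using not_c_separates_adjacent[OF simple assms(6) that(1), of S] ci[of Y S] that(2) by auto
    qed
    show "\<exists>w\<in>?A. \<forall>S \<subseteq> ?V - {T, Y}. w \<in> S \<longrightarrow> \<not> ?I Y S" if "Y \<in> Mb G T - ?A" for Y
    proof -
      have "Y \<in> csp G T" using that by (auto simp: Mb_def)
      then obtain w where w: "w \<in> ch G T"
        "\<And>S. w \<in> S \<Longrightarrow> Y \<notin> S \<Longrightarrow> T \<notin> S \<Longrightarrow> \<not> c_separates G S {Y} {T}"
        by (rule not_c_separates_csp) blast
      have Y: "Y \<in> ?V - {T}" using that Mb by auto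
      have "\<not> ?I Y S" if "S \<subseteq> ?V - {T, Y}" "w \<in> S" for S
        using ci[OF Y that(1)] w(2)[OF that(2)] that(1) by auto
      then show ?thesis using w(1) by blast
    qed
    show "?I Y S" if "Mb G T \<subseteq> S" "S \<subseteq> ?V - {T}" "Y \<in> ?V - {T} - S" for S Y
    proof -
      have "Y \<in> ?V - {T}" "S \<subseteq> ?V - {T, Y}" using that by auto
      then show ?thesis using ci Mb_c_separates[OF that(1)] by blast
    qed
    show "D.uninformedness T (C - {Y}) = D.uninformedness T C"
      if "C \<subseteq> ?V - {T}" "Y \<in> removable ?I C" for C Y
      by (rule D.uninformedness_remove[OF that(1) assms(6) that(2)])
    show "D.uninformedness T C' < D.uninformedness T C"
      if "C \<subseteq> C'" "C' \<subseteq> ?V - {T}" "Y \<in> C'" "Y \<in> dependents ?V T ?I C" for C C' Y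
      by (rule D.uninformedness_add[OF finite assms(6) that])
    show "f Y T C \<ge> 0 \<and> (f Y T C = 0 \<longleftrightarrow> ?I Y C)"
      if "C \<subseteq> ?V - {T}" "Y \<in> ?V - (C \<union> {T})" for C Y
      using assms(5)[unfolded association_measure_def, rule_format, OF assms(6) that]
      by (simp add: ci_test_def)
  qed
  show ?thesis
    by (intro conjI gs_returns_blanket iamb_returns_blanket mbc_csp_returns_blanket
        fast_iamb_returns_blanket inter_iamb_returns_blanket fdr_iamb_returns_blanket)
qed

end
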